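(* Any finitely generated subgroup $H$ of infinite index in a free group $F$ of finite rank $r>1$ is a free factor in a Burnside subgroup $K$ of infinite index in $F$ such that for any natural $k$ the right action of $F$ on $F/K$ is $k$-transitive. One can choose $K$ (with all these properties) so that the growth of the action of $F$ on $F/K$ is maximal.
   Context: $F/K$ denotes the set of right cosets $Kg$, on which $F$ acts on the right by $(Kg)h=Kgh$. A subgroup $K$ of $F$ is called Burnside if for every $g\in F$ there is a positive integer $n=n(g)$ with $g^n\in K$. The action of $F$ on $F/K$ is $k$-transitive if for any two $k$-tuples $(Kg_1,\ldots,Kg_k)$ and $(Kg'_1,\ldots,Kg'_k)$, each consisting of pairwise different cosets, there is $b\in F$ with $Kg_ib=Kg'_i$ for $i=1,\ldots,k$. Fix a free basis $X$ of $F$, $\#X=r$, and let $F(n)$ be the set of elements of reduced length at most $n$ in $X\cup X^{-1}$. The growth function of the transitive action on $F/K$ is $g(n)=\#\{Kw : w\in F(n)\}$. Functions $f,g$ are equivalent if for some nonnegative integers $C,C'$ one has $f(n)\le g(n+C)$ and $g(n)\le f(n+C')$ for all $n\ge0$. The growth is maximal if $g$ is equivalent to the growth function of the action of $F$ on itself, i.e. to $(2r-1)^n$. *)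

theory Defs
  imports "HOL-Algebra.Generated_Groups"
begin

text \<open>
  Words over a set of group elements are lists of letters: \<open>(True, x)\<close> stands for \<open>x\<close> and
  \<open>(False, x)\<close> for the inverse of \<open>x\<close>.
\<close>

definition letter_val :: "('a, 'b) monoid_scheme \<Rightarrow> bool \<times> 'a \<Rightarrow> 'a" where
  "letter_val G l = (if fst l then snd l else inv\<^bsub>G\<^esub> (snd l))"

definition word_val :: "('a, 'b) monoid_scheme \<Rightarrow> (bool \<times> 'a) list \<Rightarrow> 'a" where
  "word_val G w = foldr (\<lambda>l. (\<otimes>\<^bsub>G\<^esub>) (letter_val G l)) w \<one>\<^bsub>G\<^esub>"

definition reduced_words :: "'a set \<Rightarrow> (bool \<times> 'a) list set" where
  "reduced_words B =
     {w. snd ` set w \<subseteq> B \<and> successively (\<lambda>l m. \<not> (snd l = snd m \<and> fst l \<noteq> fst m)) w}"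

definition free_basis :: "('a, 'b) monoid_scheme \<Rightarrow> 'a set \<Rightarrow> bool" where
  "free_basis G B \<longleftrightarrow>
     B \<subseteq> carrier G \<and> bij_betw (word_val G) (reduced_words B) (carrier G)"

definition finitely_generated_subgroup :: "('a, 'b) monoid_scheme \<Rightarrow> 'a set \<Rightarrow> bool" where
  "finitely_generated_subgroup G H \<longleftrightarrow>
     subgroup H G \<and> (\<exists>S. finite S \<and> S \<subseteq> carrier G \<and> generate G S = H)"

definition infinite_index :: "('a, 'b) monoid_scheme \<Rightarrow> 'a set \<Rightarrow> bool" where
  "infinite_index G K \<longleftrightarrow> infinite (rcosets\<^bsub>G\<^esub> K)"

text \<open>
  Normal forms for the internal free product of \<open>H\<close> and \<open>L\<close>: the Boolean tag records the factor
  (\<open>True\<close> for \<open>H\<close>, \<open>False\<close> for \<open>L\<close>) from which a nontrivial syllable is taken, and the tags of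
  adjacent syllables differ.  Uniqueness of normal forms thus also forces \<open>H\<close> and \<open>L\<close> to meet
  trivially.
\<close>

definition free_product_normal_forms ::
    "('a, 'b) monoid_scheme \<Rightarrow> 'a set \<Rightarrow> 'a set \<Rightarrow> (bool \<times> 'a) list set" where
  "free_product_normal_forms G H L =
     {w. (\<forall>(i, x) \<in> set w. x \<in> (if i then H else L) \<and> x \<noteq> \<one>\<^bsub>G\<^esub>) \<and> distinct_adj (map fst w)}"

definition is_free_product :: "('a, 'b) monoid_scheme \<Rightarrow> 'a set \<Rightarrow> 'a set \<Rightarrow> 'a set \<Rightarrow> bool" where
  "is_free_product G K H L \<longleftrightarrow>
     subgroup K G \<and> subgroup H G \<and> subgroup L G \<and>
     bij_betw (\<lambda>w. foldr (\<otimes>\<^bsub>G\<^esub>) (map snd w) \<one>\<^bsub>G\<^esub>) (free_product_normal_forms G H L) K"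

definition free_factor :: "('a, 'b) monoid_scheme \<Rightarrow> 'a set \<Rightarrow> 'a set \<Rightarrow> bool" where
  "free_factor G H K \<longleftrightarrow> (\<exists>L. is_free_product G K H L)"

definition burnside_subgroup :: "('a, 'b) monoid_scheme \<Rightarrow> 'a set \<Rightarrow> bool" where
  "burnside_subgroup G K \<longleftrightarrow>
     subgroup K G \<and> (\<forall>g \<in> carrier G. \<exists>n::nat. n > 0 \<and> g [^]\<^bsub>G\<^esub> n \<in> K)"

text \<open>
  An element \<open>h\<close> acts on a right coset by right multiplication, \<open>C #> h\<close>; on \<open>K #> g\<close> this is
  \<open>K #> (g \<otimes> h)\<close> (lemma \<open>coset_mult_assoc\<close>).
\<close>

definition k_transitive_on_cosets :: "('a, 'b) monoid_scheme \<Rightarrow> 'a set \<Rightarrow> nat \<Rightarrow> bool" where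
  "k_transitive_on_cosets G K k \<longleftrightarrow>
     (\<forall>Cs Ds. length Cs = k \<and> distinct Cs \<and> set Cs \<subseteq> rcosets\<^bsub>G\<^esub> K \<and>
              length Ds = k \<and> distinct Ds \<and> set Ds \<subseteq> rcosets\<^bsub>G\<^esub> K \<longrightarrow>
        (\<exists>b \<in> carrier G. \<forall>i < k. (Cs ! i) #>\<^bsub>G\<^esub> b = Ds ! i))"

definition word_ball :: "('a, 'b) monoid_scheme \<Rightarrow> 'a set \<Rightarrow> nat \<Rightarrow> 'a set" where
  "word_ball G B n = word_val G ` {w \<in> reduced_words B. length w \<le> n}"

definition coset_growth :: "('a, 'b) monoid_scheme \<Rightarrow> 'a set \<Rightarrow> 'a set \<Rightarrow> nat \<Rightarrow> nat" where
  "coset_growth G B K n = card ((\<lambda>w. K #>\<^bsub>G\<^esub> w) ` word_ball G B n)"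

definition growth_equivalent :: "(nat \<Rightarrow> nat) \<Rightarrow> (nat \<Rightarrow> nat) \<Rightarrow> bool" where
  "growth_equivalent f g \<longleftrightarrow>
     (\<exists>C C'. \<forall>n. f n \<le> g (n + C) \<and> g n \<le> f (n + C'))"

text \<open>
  The action of \<open>G\<close> on itself is the action on the cosets of the trivial subgroup.  If \<open>B\<close> is a
  free basis with \<open>r > 1\<close> elements, its growth function is equivalent to \<open>(2 * r - 1) ^ n\<close>.
\<close>

definition maximal_growth :: "('a, 'b) monoid_scheme \<Rightarrow> 'a set \<Rightarrow> 'a set \<Rightarrow> bool" where
  "maximal_growth G B K \<longleftrightarrow>
     growth_equivalent (coset_growth G B K) (coset_growth G B {\<one>\<^bsub>G\<^esub>})"

end

theory Submission
  imports Defs Complex_Main "HOL-Library.Countable_Set"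
begin

text \<open>
  A transitive action of \<open>F\<close> with a base point is a connected labelled graph in which every
  generator acts as a permutation of the vertices, and \<open>K\<close> is the group of loops at the base
  point.  Start with a finite piece \<open>E\<close> of the coset graph of \<open>H\<close> whose loops at the base
  point spell \<open>H\<close>; since \<open>H\<close> has infinite index, some edge is missing in it (a stub).  The
  graph is completed to an infinite one by countably many finite steps.  A step either makes some
  power of a cyclically reduced word return to a given vertex, or moves one tuple of distinct
  vertices to another: paths are first prolonged far out into fresh trees, and then their ends
  are joined.

  Every vertex is named by the word leading to it in a spanning tree.  With \<open>q = 2 * r - 1\<close>, the
  stubs and the non-tree edges, weighted by \<open>q\<close> to the minus length of their source, sum up to
  exactly \<open>2 * r\<close> in any finite graph.  Joining far out makes the total weight of the non-tree
  edges stay below a bound smaller than \<open>2 * r\<close>, so that a positive proportion of stubs survives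
  at every distance; this gives infinite index and maximal growth.

  For any subgraph \<open>E\<close> of a graph \<open>G\<close> sharing its spanning tree, the loop group of \<open>E\<close> is a
  free factor of that of \<open>G\<close>: letting edges act on normal forms defines an action of the free
  group \<open>F\<close>, which recovers a normal form from its value.
\<close>

section \<open>Words and labelled graphs\<close>

text \<open>Closing every orbit and moving every tuple forces infinitely many joins, and each joined
  edge uses up two stubs for good, while maximal growth needs stubs of substantial weight to
  survive. The conflict is settled by a strict inequality instead of a plan for the whole
  construction: an edge whose ends have names of length at least \<open>N\<close> costs at most
  \<open>2 / q ^ N\<close>, so whatever slack is left under the bound pays for the next finite step.
  The first slack comes from the stub that infinite index of \<open>H\<close> leaves in the first
  graph.

  The obstacle is to find ends at which the right letter is still free. For a cyclically reduced
  word the two ends of an orbit must not run into each other; for tuples a single word has to bring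
  all entries out of the graph simultaneously.

  Names that are tree paths never change when the graph grows. Hence the first graph stays a
  subgraph in the literal sense, and \<open>H\<close> can be compared with \<open>K\<close> without
  choosing a basis of either.\<close>

definition linv :: "bool \<times> 'a \<Rightarrow> bool \<times> 'a" where
  "linv l = (\<not> fst l, snd l)"

definition winv :: "(bool \<times> 'a) list \<Rightarrow> (bool \<times> 'a) list" where
  "winv w = rev (map linv w)"

definition words :: "'a set \<Rightarrow> (bool \<times> 'a) list set" where
  "words B = {w. snd ` set w \<subseteq> B}"

abbreviation red :: "(bool \<times> 'a) list \<Rightarrow> bool" where
  "red \<equiv> successively (\<lambda>l m. m \<noteq> linv l)"

lemma linv_linv [simp]: "linv (linv l) = l"
  by (simp add: linv_def)

lemma snd_linv [simp]: "snd (linv l) = snd l"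
  by (simp add: linv_def)

lemma linv_neq [simp]: "linv l \<noteq> l" "l \<noteq> linv l"
  by (cases l; simp add: linv_def)+

lemma linv_Pair [simp]: "linv (b, x) = (\<not> b, x)"
  by (simp add: linv_def)

lemma linv_eq_iff [simp]: "linv l = linv m \<longleftrightarrow> l = m"
  by (metis linv_linv)

lemma winv_simps [simp]:
  "winv [] = []" "winv (l # w) = winv w @ [linv l]" "winv (u @ w) = winv w @ winv u"
  by (simp_all add: winv_def)

lemma winv_winv [simp]: "winv (winv w) = w"
  by (induction w) auto

lemma length_winv [simp]: "length (winv w) = length w"
  by (simp add: winv_def)

lemma winv_eq_Nil_iff [simp]: "winv w = [] \<longleftrightarrow> w = []"
  by (simp add: winv_def)

lemma words_simps [simp]:
  "[] \<in> words B" "l # w \<in> words B \<longleftrightarrow> snd l \<in> B \<and> w \<in> words B"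
  "u @ w \<in> words B \<longleftrightarrow> u \<in> words B \<and> w \<in> words B"
  by (auto simp: words_def)

lemma winv_words [simp]: "winv w \<in> words B \<longleftrightarrow> w \<in> words B"
  by (induction w) auto

lemma reduced_words_eq:
  fixes B :: "'a set"
  shows "reduced_words B = {w \<in> words B. red w}"
proof -
  have "(\<lambda>l m. \<not> (snd l = snd m \<and> fst l \<noteq> fst m)) = (\<lambda>l m. m \<noteq> linv (l :: bool \<times> 'a))"
    by (intro ext) (auto simp: linv_def prod_eq_iff)
  then show ?thesis unfolding reduced_words_def words_def by (simp only:) simp
qed

lemma red_winv:
  fixes w :: "(bool \<times> 'a) list"
  shows "red (winv w) \<longleftrightarrow> red w"
proof -
  have "(\<lambda>l m. linv l \<noteq> m) = (\<lambda>l m. m \<noteq> linv (l :: bool \<times> 'a))"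
    by (intro ext) auto
  then show ?thesis unfolding winv_def successively_rev successively_map linv_linv by (simp only:)
qed

text \<open>Stripping a letter from both ends keeps the equation, which finally leaves one letter
  equal to its inverse or two adjacent letters that cancel. For words, this is the absence of
  elements of order two in a free group.\<close>

lemma red_winv_fixed:
  assumes "red w" "winv w = w"
  shows "w = []"
  using assms
proof (induction "length w" arbitrary: w rule: less_induct)
  case less
  show ?case
  proof (cases w)
    case (Cons l w')
    show ?thesis
    proof (cases w' rule: rev_exhaust)
      case Nil
      with Cons less.prems show ?thesis by simp
    next
      case (snoc u m)
      with Cons less.prems have "winv u = u" "linv m = l" by auto
      moreover have "red u"
        using less.prems(1) Cons snoc by (auto simp: successively_append_iff successively_Cons)
      ultimately have "u = []" using less.hyps[of u] Cons snoc by auto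
      with Cons snoc less.prems(1) \<open>linv m = l\<close> show ?thesis by auto
    qed
  qed simp
qed

section \<open>Periodic words and cyclic reduction\<close>

definition wpow :: "'b list \<Rightarrow> nat \<Rightarrow> 'b list" where
  "wpow c n = concat (replicate n c)"

lemma wpow_simps [simp]: "wpow c 0 = []" "wpow c (Suc n) = c @ wpow c n"
  by (simp_all add: wpow_def)

lemma wpow_add: "wpow c (m + n) = wpow c m @ wpow c n"
  by (induction m) auto

lemma wpow_Suc': "wpow c (Suc n) = wpow c n @ c"
  using wpow_add[of c n 1] by simp

lemma length_wpow [simp]: "length (wpow c n) = n * length c"
  by (induction n) auto

lemma wpow_words: "c \<in> words B \<Longrightarrow> wpow c n \<in> words B"
  by (induction n) auto

lemma winv_wpow: "winv (wpow c n) = wpow (winv c) n"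
proof (induction n)
  case (Suc n)
  then show ?case unfolding wpow_Suc'[of "winv c"] by simp
qed simp

text \<open>A window of one period length starts inside some copy of \<open>c\<close> and ends
  inside the next, so it is a tail of \<open>c\<close> followed by the matching head.\<close>

lemma factor_of_wpow:
  assumes "wpow c n = u @ d @ v" "length d = length c"
  shows "\<exists>a b. c = a @ b \<and> d = b @ a"
  using assms
proof (induction n arbitrary: u)
  case (Suc n)
  show ?case
  proof (cases "length c \<le> length u")
    case True
    then obtain u' where "u = c @ u'"
      using Suc.prems(1) by (auto simp: append_eq_append_conv2)
    then show ?thesis using Suc by auto
  next
    case False
    then obtain b where b: "c = u @ b" "b @ wpow c n = d @ v"
      using Suc.prems(1) by (auto simp: append_eq_append_conv2)
    then obtain a where a: "d = b @ a" "wpow c n = a @ v"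
      using Suc.prems(2) by (auto simp: append_eq_append_conv2)
    then have la: "length a = length u" using Suc.prems(2) b by simp
    show ?thesis
    proof (cases n)
      case 0
      with a la b show ?thesis by auto
    next
      case (Suc m)
      then have "u @ (b @ wpow c m) = a @ v" using a b by simp
      with la have "a = u" by (metis append_eq_append_conv)
      then show ?thesis using a b by auto
    qed
  qed
qed auto

text \<open>For nonempty \<open>c\<close> this says that \<open>c @ c\<close> is reduced, so powers
  of \<open>c\<close> involve no cancellation.\<close>

definition cyc_red :: "(bool \<times> 'a) list \<Rightarrow> bool" where
  "cyc_red c \<longleftrightarrow> c \<noteq> [] \<and> red c \<and> hd c \<noteq> linv (last c)"

lemma cyc_red_winv: "cyc_red c \<Longrightarrow> cyc_red (winv c)"
  unfolding cyc_red_def red_winv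
  by (simp add: hd_map hd_rev last_map last_rev winv_def) (metis linv_linv)

lemma red_wpow: "cyc_red c \<Longrightarrow> red (wpow c n)"
proof (induction n)
  case (Suc n)
  then show ?case
    by (cases n) (auto simp: cyc_red_def successively_append_iff)
qed simp

text \<open>Comparing the two spellings of \<open>winv c\<close> block by block makes
  \<open>a\<close> and \<open>b\<close> their own formal inverses, hence empty. It is the
  combinatorial form of the fact that a nontrivial element of a free group is not conjugate to its
  inverse.\<close>

lemma not_rotation_of_winv:
  assumes "cyc_red c" "winv c = a @ b" "c = b @ a"
  shows False
proof -
  have "a @ b = winv a @ winv b" using assms(2,3) by simp
  then have "winv a = a" "winv b = b" by (metis append_eq_append_conv length_winv)+
  moreover have "red a" "red b"
    using assms(1,3) by (auto simp: cyc_red_def successively_append_iff)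
  ultimately show False using red_winv_fixed assms(1,3) by (fastforce simp: cyc_red_def)
qed

fun wred :: "(bool \<times> 'a) list \<Rightarrow> (bool \<times> 'a) list" where
  "wred [] = []"
| "wred (l # w) =
     (case wred w of [] \<Rightarrow> [l] | m # u \<Rightarrow> if m = linv l then u else l # m # u)"

lemma red_wred: "red (wred w)"
  by (induction w) (auto split: list.splits simp: successively_Cons)

lemma wred_words: "w \<in> words B \<Longrightarrow> wred w \<in> words B"
  by (induction w) (auto split: list.splits)

section \<open>Paths in graphs with inverse edges\<close>

fun path :: "('s \<times> (bool \<times> 'a) \<times> 's) set \<Rightarrow> 's \<Rightarrow> (bool \<times> 'a) list \<Rightarrow> 's \<Rightarrow> bool" where
  "path T s [] t \<longleftrightarrow> s = t"
| "path T s (l # w) t \<longleftrightarrow> (\<exists>s'. (s, l, s') \<in> T \<and> path T s' w t)"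

text \<open>Every letter acts as a partial injection, its inverse letter as the inverse map. The
  vertex type stays open, because the notion also serves for vertices paired with normal
  forms.\<close>

definition inv_graph :: "('s \<times> (bool \<times> 'a) \<times> 's) set \<Rightarrow> bool" where
  "inv_graph T \<longleftrightarrow>
     (\<forall>s l t. (s, l, t) \<in> T \<longrightarrow> (t, linv l, s) \<in> T) \<and>
     (\<forall>s l t t'. (s, l, t) \<in> T \<longrightarrow> (s, l, t') \<in> T \<longrightarrow> t = t')"

lemma inv_graph_sym: "inv_graph T \<Longrightarrow> (s, l, t) \<in> T \<Longrightarrow> (t, linv l, s) \<in> T"
  unfolding inv_graph_def by blast

lemma inv_graph_det: "inv_graph T \<Longrightarrow> (s, l, t) \<in> T \<Longrightarrow> (s, l, t') \<in> T \<Longrightarrow> t = t'"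
  unfolding inv_graph_def by blast

lemma inv_graph_inj: "inv_graph T \<Longrightarrow> (s, l, t) \<in> T \<Longrightarrow> (s', l, t) \<in> T \<Longrightarrow> s = s'"
  using inv_graph_sym inv_graph_det by metis

lemma path_append: "path T s (u @ w) t \<longleftrightarrow> (\<exists>s'. path T s u s' \<and> path T s' w t)"
  by (induction u arbitrary: s) auto

lemma path_mono: "path T s w t \<Longrightarrow> T \<subseteq> T' \<Longrightarrow> path T' s w t"
  by (induction w arbitrary: s) auto

lemma path_det: "inv_graph T \<Longrightarrow> path T s w t \<Longrightarrow> path T s w t' \<Longrightarrow> t = t'"
proof (induction w arbitrary: s)
  case (Cons l w)
  then show ?case by (metis inv_graph_det path.simps(2))
qed simp

lemma path_winv: "inv_graph T \<Longrightarrow> path T s w t \<Longrightarrow> path T t (winv w) s"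
  by (induction w arbitrary: s) (auto simp: path_append dest: inv_graph_sym)

lemma path_winv_iff: "inv_graph T \<Longrightarrow> path T t (winv w) s \<longleftrightarrow> path T s w t"
  by (metis path_winv winv_winv)

lemma path_inj: "inv_graph T \<Longrightarrow> path T s w t \<Longrightarrow> path T s' w t \<Longrightarrow> s = s'"
  using path_winv path_det by metis

text \<open>Reading \<open>l\<close> and then \<open>linv l\<close> returns to the same vertex by
  determinism, so free reduction can be carried out along any existing path. The converse fails: a
  reduced word may be readable where the longer one is not.\<close>

lemma path_wred: "inv_graph T \<Longrightarrow> path T s w t \<Longrightarrow> path T s (wred w) t"
proof (induction w arbitrary: s)
  case (Cons l w)
  then obtain s' where s': "(s, l, s') \<in> T" "path T s' (wred w) t" by auto
  show ?case
  proof (cases "wred w")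
    case (Cons m u)
    show ?thesis
    proof (cases "m = linv l")
      case True
      with Cons s' obtain s'' where "(s', linv l, s'') \<in> T" "path T s'' u t" by auto
      moreover from this have "s'' = s"
        using inv_graph_sym[OF \<open>inv_graph T\<close> s'(1)] inv_graph_det[OF \<open>inv_graph T\<close>] by blast
      ultimately show ?thesis using True Cons by simp
    qed (use Cons s' in auto)
  qed (use s' in auto)
qed simp

lemma path_wpow_loop: "path T s c s \<Longrightarrow> path T s (wpow c n) s"
  by (induction n) (auto simp: path_append)

text \<open>Pigeonhole gives a repeated vertex on the orbit of \<open>s\<close>; since powers act
  injectively, cancelling the common power carries the repetition back to \<open>s\<close>. So an
  orbit that does not close up must leave a finite graph.\<close>

lemma path_wpow_total:
  assumes "inv_graph T" "finite S" "\<And>n. \<exists>t \<in> S. path T s (wpow c n) t"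
  shows "\<exists>n > 0. path T s (wpow c n) s"
proof -
  from assms(3) obtain f where f: "\<And>n. f n \<in> S" "\<And>n. path T s (wpow c n) (f n)" by metis
  have "\<not> inj f"
    using f(1) assms(2) by (metis finite_subset image_subset_iff infinite_UNIV_nat finite_imageD)
  then obtain i j where ij: "i < j" "f i = f j"
    unfolding inj_def by (metis linorder_neqE_nat)
  then have "wpow c j = wpow c (j - i) @ wpow c i"
    by (simp flip: wpow_add)
  with f(2)[of j] obtain z where z: "path T s (wpow c (j - i)) z" "path T z (wpow c i) (f j)"
    by (auto simp: path_append)
  then have "z = s" using path_inj[OF assms(1)] f(2)[of i] ij by metis
  then show ?thesis using z ij by (intro exI[of _ "j - i"]) auto
qed

section \<open>Free groups\<close>

lemma word_val_simps [simp]: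
  "word_val G [] = \<one>\<^bsub>G\<^esub>" "word_val G (l # w) = letter_val G l \<otimes>\<^bsub>G\<^esub> word_val G w"
  by (simp_all add: word_val_def)

context group
begin

lemma letter_val_closed [simp]: "snd l \<in> carrier G \<Longrightarrow> letter_val G l \<in> carrier G"
  by (simp add: letter_val_def)

lemma letter_val_linv: "snd l \<in> carrier G \<Longrightarrow> letter_val G (linv l) = inv letter_val G l"
  by (simp add: letter_val_def linv_def)

lemma word_val_closed [simp]: "w \<in> words (carrier G) \<Longrightarrow> word_val G w \<in> carrier G"
  by (induction w) auto

lemma word_val_append:
  "u \<in> words (carrier G) \<Longrightarrow> w \<in> words (carrier G) \<Longrightarrow>
   word_val G (u @ w) = word_val G u \<otimes> word_val G w"
  by (induction u) (auto simp: m_assoc)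

lemma word_val_winv:
  "w \<in> words (carrier G) \<Longrightarrow> word_val G (winv w) = inv word_val G w"
  by (induction w) (auto simp: word_val_append letter_val_linv inv_mult_group)

lemma word_val_wpow:
  "w \<in> words (carrier G) \<Longrightarrow> word_val G (wpow w n) = word_val G w [^] n"
proof (induction n)
  case (Suc n)
  then show ?case
    unfolding wpow_Suc' by (simp add: word_val_append wpow_words)
qed simp

lemma word_val_wred: "w \<in> words (carrier G) \<Longrightarrow> word_val G (wred w) = word_val G w"
proof (induction w)
  case (Cons l w)
  show ?case
  proof (cases "wred w")
    case (Cons m u)
    have u: "m # u \<in> words (carrier G)"
      using wred_words[of w] Cons Cons.prems by (metis words_simps(2))
    have eq: "word_val G w = letter_val G m \<otimes> word_val G u"
      using Cons Cons.prems Cons.IH by simp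
    show ?thesis
    proof (cases "m = linv l")
      case True
      then show ?thesis
        using Cons eq u Cons.prems by (simp add: letter_val_linv m_assoc [symmetric])
    qed (use Cons eq in simp)
  qed (use Cons in auto)
qed simp

end

locale free_group = group F for F (structure) +
  fixes B :: "'a set"
  assumes basis: "free_basis F B"
begin

lemma basis_carrier: "B \<subseteq> carrier F"
  using basis by (simp add: free_basis_def)

lemma words_carrier: "w \<in> words B \<Longrightarrow> w \<in> words (carrier F)"
  using basis_carrier by (auto simp: words_def)

lemma carrier_word:
  assumes "g \<in> carrier F"
  obtains w where "w \<in> words B" "word_val F w = g"
proof -
  have "g \<in> word_val F ` {w \<in> words B. red w}"
    using assms basis by (simp add: free_basis_def bij_betw_def reduced_words_eq)
  then show ?thesis using that by blast
qed

lemma wred_eqI: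
  assumes "u \<in> words B" "w \<in> words B" "word_val F u = word_val F w"
  shows "wred u = wred w"
proof -
  have "wred u \<in> reduced_words B" "wred w \<in> reduced_words B"
    using assms by (auto simp: reduced_words_eq wred_words red_wred)
  moreover have "word_val F (wred u) = word_val F (wred w)"
    using assms by (simp add: word_val_wred words_carrier)
  ultimately show ?thesis
    using basis unfolding free_basis_def bij_betw_def inj_on_def by blast
qed

text \<open>Words of equal value have the same reduced form, and that form leads to both ends.
  Freeness of the basis enters here: any inverse graph carries a well-defined partial action of
  \<open>F\<close>.\<close>

lemma path_cong_word_val:
  assumes "inv_graph T" "u \<in> words B" "w \<in> words B" "word_val F u = word_val F w"
    "path T s u t" "path T s w t'"
  shows "t = t'"
  using path_wred[OF assms(1,5)] path_wred[OF assms(1,6)] wred_eqI[OF assms(2-4)]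
    path_det[OF assms(1)] by metis

text \<open>Peeling off cancelling outer pairs stops at a word whose ends do not cancel. This
  reduces the Burnside condition to cyclically reduced words, at the price of asking for it at every
  vertex, since \<open>u\<close> moves the base point.\<close>

lemma cyc_red_conjugate:
  assumes "w \<in> words B"
  shows "\<exists>u c. u \<in> words B \<and> c \<in> words B \<and> (c = [] \<or> cyc_red c) \<and>
           word_val F w = word_val F (u @ c @ winv u)"
proof -
  have "\<exists>u c. u \<in> words B \<and> c \<in> words B \<and> (c = [] \<or> cyc_red c) \<and>
           word_val F w = word_val F (u @ c @ winv u)" if "red w" "w \<in> words B" for w
    using that
  proof (induction "length w" arbitrary: w rule: less_induct)
    case less
    show ?case
    proof (cases "w = [] \<or> cyc_red w")
      case True
      with less show ?thesis by (intro exI[of _ "[]"] exI[of _ w]) auto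
    next
      case False
      with less.prems have ne: "w \<noteq> []" "hd w = linv (last w)" by (auto simp: cyc_red_def)
      obtain l w' where w: "w = l # w'" using ne by (cases w) auto
      with ne have "w' \<noteq> []" by auto
      then obtain v m where w': "w' = v @ [m]" by (metis rev_exhaust)
      with w ne have l: "m = linv l" by simp
      have v: "red v" "v \<in> words B" "length v < length w" "snd l \<in> B"
        using less.prems w w' by (auto simp: successively_append_iff successively_Cons)
      from less.hyps[OF v(3,1,2)] obtain u c where uc: "u \<in> words B" "c \<in> words B"
        "c = [] \<or> cyc_red c" "word_val F v = word_val F (u @ c @ winv u)" by blast
      have "word_val F w = word_val F ((l # u) @ c @ winv (l # u))"
        using uc v w w' l basis_carrier
        by (auto simp: word_val_append words_carrier m_assoc subset_iff)
      then show ?thesis using uc v by (intro exI[of _ "l # u"] exI[of _ c]) auto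
    qed
  qed
  from this[of "wred w"] assms show ?thesis
    by (simp add: red_wred wred_words word_val_wred words_carrier)
qed

end

section \<open>Graphs with named vertices\<close>

text \<open>The last condition encodes a spanning tree in the names: the edge into \<open>v\<close>
  from its prefix is always present, so the graph is connected and the word \<open>v\<close> leads
  from \<open>[]\<close> to \<open>v\<close>.\<close>

definition pgraph :: "'a set \<Rightarrow> ((bool \<times> 'a) list \<times> (bool \<times> 'a) \<times> (bool \<times> 'a) list) set \<Rightarrow> bool" where
  "pgraph B E \<longleftrightarrow> inv_graph E \<and>
     (\<forall>v l u. (v, l, u) \<in> E \<longrightarrow> snd l \<in> B \<and> (v \<noteq> [] \<longrightarrow> (butlast v, last v, v) \<in> E))"

text \<open>The base point \<open>[]\<close> is present even in the graph without edges.\<close>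

definition verts :: "('b list \<times> 'b \<times> 'b list) set \<Rightarrow> 'b list set" where
  "verts E = insert [] (fst ` E)"

definition stubs ::
    "'a set \<Rightarrow> ((bool \<times> 'a) list \<times> (bool \<times> 'a) \<times> (bool \<times> 'a) list) set \<Rightarrow>
     ((bool \<times> 'a) list \<times> (bool \<times> 'a)) set" where
  "stubs B E = {(v, l). v \<in> verts E \<and> snd l \<in> B \<and> (\<forall>u. (v, l, u) \<notin> E)}"

definition arcs :: "'s \<Rightarrow> bool \<times> 'a \<Rightarrow> 's \<Rightarrow> ('s \<times> (bool \<times> 'a) \<times> 's) set" where
  "arcs v l u = {(v, l, u), (u, linv l, v)}"

definition nontree ::
    "((bool \<times> 'a) list \<times> (bool \<times> 'a) \<times> (bool \<times> 'a) list) set \<Rightarrow>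
     ((bool \<times> 'a) list \<times> (bool \<times> 'a) \<times> (bool \<times> 'a) list) set" where
  "nontree E = {(v, l, u) \<in> E. u \<noteq> v @ [l] \<and> v \<noteq> u @ [linv l]}"

text \<open>Edges are stored in both directions, so a non-tree edge is weighed once at each of its
  ends.\<close>

definition loss :: "real \<Rightarrow> ((bool \<times> 'a) list \<times> (bool \<times> 'a) \<times> (bool \<times> 'a) list) set \<Rightarrow> real" where
  "loss q E = (\<Sum>(v, l, u) \<in> nontree E. 1 / q ^ length v)"

lemma pgraph_inv_graph: "pgraph B E \<Longrightarrow> inv_graph E"
  by (simp add: pgraph_def)

lemma pgraph_sym: "pgraph B E \<Longrightarrow> (v, l, u) \<in> E \<Longrightarrow> (u, linv l, v) \<in> E"
  using pgraph_inv_graph inv_graph_sym by metis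

lemma pgraph_det: "pgraph B E \<Longrightarrow> (v, l, u) \<in> E \<Longrightarrow> (v, l, u') \<in> E \<Longrightarrow> u = u'"
  using pgraph_inv_graph inv_graph_det by metis

lemma pgraph_letter: "pgraph B E \<Longrightarrow> (v, l, u) \<in> E \<Longrightarrow> snd l \<in> B"
  unfolding pgraph_def by blast

lemma verts_Nil [simp]: "[] \<in> verts E"
  by (simp add: verts_def)

lemma verts_cases: "v \<in> verts E \<Longrightarrow> v = [] \<or> (\<exists>l u. (v, l, u) \<in> E)"
  by (auto simp: verts_def)

lemma verts_source: "(v, l, u) \<in> E \<Longrightarrow> v \<in> verts E"
  by (force simp: verts_def)

lemma verts_target: "pgraph B E \<Longrightarrow> (v, l, u) \<in> E \<Longrightarrow> u \<in> verts E"
  using pgraph_sym verts_source by metis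

lemma verts_mono: "E \<subseteq> E' \<Longrightarrow> verts E \<subseteq> verts E'"
  by (auto simp: verts_def)

lemma finite_verts: "finite E \<Longrightarrow> finite (verts E)"
  by (simp add: verts_def)

lemma verts_snoc: "pgraph B E \<Longrightarrow> v @ [l] \<in> verts E \<Longrightarrow> (v, l, v @ [l]) \<in> E"
  unfolding pgraph_def verts_def by fastforce

lemma pgraph_tree: "pgraph B E \<Longrightarrow> v \<in> verts E \<Longrightarrow> v \<noteq> [] \<Longrightarrow> (butlast v, last v, v) \<in> E"
  by (metis append_butlast_last_id verts_snoc)

lemma path_to_vert: "pgraph B E \<Longrightarrow> v \<in> verts E \<Longrightarrow> path E [] v v"
proof (induction v rule: rev_induct)
  case (snoc l v)
  then show ?case using verts_snoc[of B E v l] verts_source by (fastforce simp: path_append)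
qed simp

lemma path_verts: "pgraph B E \<Longrightarrow> path E v w u \<Longrightarrow> v \<in> verts E \<Longrightarrow> u \<in> verts E"
  by (induction w arbitrary: v) (auto intro: verts_target)

lemma path_words: "pgraph B E \<Longrightarrow> path E v w u \<Longrightarrow> w \<in> words B"
  by (induction w arbitrary: v) (auto dest: pgraph_letter)

lemma verts_words: "pgraph B E \<Longrightarrow> v \<in> verts E \<Longrightarrow> v \<in> words B"
  using path_to_vert path_words by metis

text \<open>If the last two letters cancelled, the edge naming \<open>v @ [l]\<close> would be the
  one leading back to the prefix of \<open>v\<close>, against determinism. Being reduced, the names
  of vertices can be counted in word balls.\<close>

lemma verts_red: "pgraph B E \<Longrightarrow> v \<in> verts E \<Longrightarrow> red v"
proof (induction v rule: rev_induct)
  case (snoc l v)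
  have e: "(v, l, v @ [l]) \<in> E" using verts_snoc snoc.prems by metis
  then have "v \<in> verts E" by (rule verts_source)
  show ?case
  proof (cases v rule: rev_exhaust)
    case [simp]: (snoc u m)
    have e': "(v, linv m, u) \<in> E"
      using verts_snoc[of B E u m] pgraph_sym snoc.prems \<open>v \<in> verts E\<close> by fastforce
    have "l \<noteq> linv m" using pgraph_det[OF snoc.prems(1) e'] e by auto
    then show ?thesis using snoc.IH[OF snoc.prems(1) \<open>v \<in> verts E\<close>]
      by (auto simp: successively_append_iff)
  qed simp
qed simp

lemma stubs_snoc: "pgraph B E \<Longrightarrow> (v, l) \<in> stubs B E \<Longrightarrow> v @ [l] \<notin> verts E"
  using verts_snoc unfolding stubs_def by blast

lemma stubs_vert: "(v, l) \<in> stubs B E \<Longrightarrow> v \<in> verts E \<and> snd l \<in> B"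
  by (auto simp: stubs_def)

lemma pgraph_empty: "pgraph B {}"
  by (simp add: pgraph_def inv_graph_def)

lemma pgraph_expand:
  assumes "pgraph B E" "(v, l) \<in> stubs B E"
  shows "pgraph B (E \<union> arcs v l (v @ [l]))"
proof -
  have new: "(s, m, t) \<in> E \<Longrightarrow> s \<noteq> v @ [l]" for s m t
    using verts_source stubs_snoc[OF assms] by metis
  have st: "(v, l, u) \<notin> E" for u using assms(2) by (auto simp: stubs_def)
  have v: "v \<noteq> [] \<Longrightarrow> (butlast v, last v, v) \<in> E"
    using assms stubs_vert[OF assms(2)] by (metis append_butlast_last_id verts_snoc)
  show ?thesis
    unfolding pgraph_def inv_graph_def
  proof (intro conjI allI impI)
    fix s m t assume "(s, m, t) \<in> E \<union> arcs v l (v @ [l])"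
    then show "(t, linv m, s) \<in> E \<union> arcs v l (v @ [l])"
      by (auto simp: arcs_def dest: pgraph_sym[OF assms(1)])
  next
    fix s m t t' assume "(s, m, t) \<in> E \<union> arcs v l (v @ [l])" "(s, m, t') \<in> E \<union> arcs v l (v @ [l])"
    then show "t = t'"
      by (auto simp: arcs_def st dest: pgraph_det[OF assms(1)] new)
  next
    fix s m t assume "(s, m, t) \<in> E \<union> arcs v l (v @ [l])"
    then show "snd m \<in> B" using stubs_vert[OF assms(2)]
      by (auto simp: arcs_def dest: pgraph_letter[OF assms(1)])
  next
    fix s m t assume "(s, m, t) \<in> E \<union> arcs v l (v @ [l])" "s \<noteq> []"
    then show "(butlast s, last s, s) \<in> E \<union> arcs v l (v @ [l])"
      using v by (auto simp: arcs_def dest: verts_source intro: pgraph_tree[OF assms(1)])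
  qed
qed

lemma verts_expand:
  assumes "(v, l) \<in> stubs B E"
  shows "verts (E \<union> arcs v l (v @ [l])) = insert (v @ [l]) (verts E)"
  using stubs_vert[OF assms] by (auto simp: verts_def arcs_def)

lemma nontree_expand: "nontree (E \<union> arcs v l (v @ [l])) = nontree E"
  by (auto simp: nontree_def arcs_def)

text \<open>All ends are joined at once by one letter, as moving a tuple by a single word requires.
  Injectivity of \<open>\<tau>\<close> keeps the edges labelled \<open>linv l\<close>
  deterministic.\<close>

lemma pgraph_connect:
  assumes "pgraph B E" "\<And>p. p \<in> dom \<tau> \<Longrightarrow> (p, l) \<in> stubs B E"
    "\<And>p q. \<tau> p = Some q \<Longrightarrow> (q, linv l) \<in> stubs B E" "inj_on \<tau> (dom \<tau>)"
  shows "pgraph B (E \<union> {(p, l, q) |p q. \<tau> p = Some q} \<union> {(q, linv l, p) |p q. \<tau> p = Some q})"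
    (is "pgraph B ?E")
    and "verts (E \<union> {(p, l, q) |p q. \<tau> p = Some q} \<union> {(q, linv l, p) |p q. \<tau> p = Some q}) = verts E"
proof -
  have st: "\<tau> p = Some q \<Longrightarrow> (p, l, u) \<notin> E" "\<tau> p = Some q \<Longrightarrow> (q, linv l, u) \<notin> E" for p q u
    using assms(2)[of p] assms(3)[of p q] by (auto simp: stubs_def)
  have vt: "\<tau> p = Some q \<Longrightarrow> p \<in> verts E \<and> q \<in> verts E \<and> snd l \<in> B" for p q
    using assms(2)[of p] assms(3)[of p q] by (auto simp: stubs_def)
  have inj: "\<tau> p = Some q \<Longrightarrow> \<tau> p' = Some q \<Longrightarrow> p = p'" for p p' q
    using assms(4) unfolding inj_on_def by (metis domI)
  have tree: "v \<in> verts E \<Longrightarrow> v \<noteq> [] \<Longrightarrow> (butlast v, last v, v) \<in> E" for v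
    using assms(1) by (metis append_butlast_last_id verts_snoc)
  show ve: "verts ?E = verts E"
  proof
    show "verts E \<subseteq> verts ?E" by (rule verts_mono) auto
    show "verts ?E \<subseteq> verts E"
    proof
      fix v assume "v \<in> verts ?E"
      then show "v \<in> verts E"
        using vt verts_cases[of v ?E] by (auto dest: verts_source)
    qed
  qed
  show "pgraph B ?E"
    unfolding pgraph_def inv_graph_def
  proof (intro conjI allI impI)
    fix s m t assume "(s, m, t) \<in> ?E"
    then show "(t, linv m, s) \<in> ?E" by (auto dest: pgraph_sym[OF assms(1)])
  next
    fix s m t t' assume "(s, m, t) \<in> ?E" "(s, m, t') \<in> ?E"
    then show "t = t'" by (auto simp: st dest: pgraph_det[OF assms(1)] inj)
  next
    fix s m t assume "(s, m, t) \<in> ?E"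
    then show "snd m \<in> B" using vt by (auto dest: pgraph_letter[OF assms(1)])
  next
    fix s m t assume *: "(s, m, t) \<in> ?E" "s \<noteq> []"
    have "s \<in> verts E" using ve verts_source[OF *(1)] by simp
    then show "(butlast s, last s, s) \<in> ?E" using tree * by auto
  qed
qed

section \<open>Weights of stubs and non-tree edges\<close>

lemma sum_union_le:
  fixes f :: "'b \<Rightarrow> real"
  assumes "finite A" "finite C" "\<And>x. f x \<ge> 0"
  shows "sum f (A \<union> C) \<le> sum f A + sum f C"
  using sum_Un[OF assms(1,2), of f] sum_nonneg[of "A \<inter> C" f] assms(3) by simp

lemma loss_connect:
  assumes "finite E" "finite (dom \<tau>)" "card (dom \<tau>) \<le> k" "q \<ge> 1"
    "\<And>p p'. \<tau> p = Some p' \<Longrightarrow> length p \<ge> N \<and> length p' \<ge> N"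
  shows "loss q (E \<union> {(p, l, p') |p p'. \<tau> p = Some p'} \<union> {(p', linv l, p) |p p'. \<tau> p = Some p'})
           \<le> loss q E + 2 * real k / q ^ N" (is "loss q (E \<union> ?X \<union> ?Y) \<le> _")
    and "finite (E \<union> {(p, l, p') |p p'. \<tau> p = Some p'} \<union> {(p', linv l, p) |p p'. \<tau> p = Some p'})"
proof -
  let ?f = "\<lambda>(v :: (bool \<times> 'a) list, l :: bool \<times> 'a, u :: (bool \<times> 'a) list). 1 / q ^ length v"
  have X: "?X = (\<lambda>p. (p, l, the (\<tau> p))) ` dom \<tau>" and Y: "?Y = (\<lambda>p. (the (\<tau> p), linv l, p)) ` dom \<tau>"
    by (force simp: dom_def)+
  have fin: "finite ?X" "finite ?Y" unfolding X Y using assms(2) by auto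
  have cX: "card ?X \<le> k" unfolding X using card_image_le[OF assms(2)] assms(3) le_trans by blast
  have cY: "card ?Y \<le> k" unfolding Y using card_image_le[OF assms(2)] assms(3) le_trans by blast
  show "finite (E \<union> ?X \<union> ?Y)" using fin assms(1) by simp
  have fN: "finite (nontree E)" by (rule finite_subset[OF _ assms(1)]) (auto simp: nontree_def)
  have nn: "?f x \<ge> 0" for x using assms(4) by (auto split: prod.splits)
  have bnd: "sum ?f Z \<le> real k / q ^ N" if "finite Z" "card Z \<le> k"
    "\<And>v l u. (v, l, u) \<in> Z \<Longrightarrow> length v \<ge> N" for Z
  proof -
    have "sum ?f Z \<le> real (card Z) * (1 / q ^ N)"
    proof (rule sum_bounded_above)
      fix x assume "x \<in> Z"
      then show "?f x \<le> 1 / q ^ N"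
        using that(3) assms(4) by (auto split: prod.splits intro!: divide_left_mono power_increasing)
    qed
    also have "\<dots> \<le> real k * (1 / q ^ N)"
      using that(2) assms(4) by (intro mult_right_mono) auto
    finally show ?thesis by simp
  qed
  have 1: "loss q (E \<union> ?X \<union> ?Y) \<le> sum ?f (nontree E \<union> (?X \<union> ?Y))"
    unfolding loss_def
  proof (rule sum_mono2)
    show "finite (nontree E \<union> (?X \<union> ?Y))" using fN fin by blast
    show "nontree (E \<union> ?X \<union> ?Y) \<subseteq> nontree E \<union> (?X \<union> ?Y)"
      unfolding nontree_def by blast
  qed (rule nn)
  have 2: "sum ?f (nontree E \<union> (?X \<union> ?Y)) \<le> sum ?f (nontree E) + sum ?f (?X \<union> ?Y)"
    by (rule sum_union_le[OF fN finite_UnI[OF fin] nn])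
  have 3: "sum ?f (?X \<union> ?Y) \<le> sum ?f ?X + sum ?f ?Y"
    by (rule sum_union_le[OF fin nn])
  have 4: "sum ?f ?X \<le> real k / q ^ N" using assms(5) by (intro bnd fin cX) auto
  have 5: "sum ?f ?Y \<le> real k / q ^ N" using assms(5) by (intro bnd fin cY) auto
  have 6: "2 * real k / q ^ N = real k / q ^ N + real k / q ^ N" by simp
  have 7: "loss q E = sum ?f (nontree E)" by (simp only: loss_def)
  show "loss q (E \<union> ?X \<union> ?Y) \<le> loss q E + 2 * real k / q ^ N"
    unfolding 6 7 using 1 2 3 4 5 by linarith
qed

text \<open>Every pair of a vertex and a letter gets the weight of the vertex. The tree edge into
  \<open>u \<noteq> []\<close> weighs \<open>q / q ^ length u\<close> at its upper end and
  \<open>1 / q ^ length u\<close> at \<open>u\<close>; together this is the weight of all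
  \<open>2 * card B\<close> letters at \<open>u\<close>, because \<open>q + 1 = 2 * card B\<close>.
  These shares cancel, and only that of the base point remains.\<close>

lemma loss_identity:
  assumes "pgraph B E" "finite E" "finite B" "q = 2 * real (card B) - 1" "q > 0"
  shows "(\<Sum>(v, l) \<in> stubs B E. 1 / q ^ length v) + loss q E = 2 * real (card B)"
proof -
  let ?V = "verts E" and ?L = "(UNIV :: bool set) \<times> B"
  let ?f = "\<lambda>v :: (bool \<times> 'a) list. 1 / q ^ length v"
  let ?D = "{(v, l, u) \<in> E. u = v @ [l]}" and ?U = "{(v, l, u) \<in> E. v = u @ [linv l]}"
  have fV: "finite ?V" using assms(2) by (rule finite_verts)
  have cL: "card ?L = 2 * card B" by (simp add: card_cartesian_product)
  have part: "?V \<times> ?L = stubs B E \<union> (\<lambda>(v, l, u). (v, l)) ` E"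
    by (auto simp: stubs_def image_iff dest: verts_source pgraph_letter[OF assms(1)])
  have disj: "stubs B E \<inter> (\<lambda>(v, l, u). (v, l)) ` E = {}"
    by (auto simp: stubs_def)
  have fS: "finite (stubs B E)"
    by (rule finite_subset[of _ "?V \<times> ?L"]) (auto simp: stubs_def fV assms(3))
  have inj: "inj_on (\<lambda>(v, l, u). (v, l)) E"
    using pgraph_det[OF assms(1)] by (auto simp: inj_on_def)
  have "2 * real (card B) * sum ?f ?V = (\<Sum>v \<in> ?V. \<Sum>l \<in> ?L. ?f v)"
    by (simp add: cL sum_distrib_left mult_ac)
  also have "\<dots> = (\<Sum>(v, l) \<in> ?V \<times> ?L. ?f v)"
    by (rule sum.cartesian_product)
  also have "\<dots> = (\<Sum>(v, l) \<in> stubs B E. ?f v) + (\<Sum>(v, l) \<in> (\<lambda>(v, l, u). (v, l)) ` E. ?f v)"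
    unfolding part using fS assms(2) disj by (intro sum.union_disjoint) auto
  also have "(\<Sum>(v, l) \<in> (\<lambda>(v, l, u). (v, l)) ` E. ?f v) = (\<Sum>(v, l, u) \<in> E. ?f v)"
    by (subst sum.reindex[OF inj]) (auto intro: sum.cong)
  also have "\<dots> = (\<Sum>(v, l, u) \<in> nontree E \<union> (?D \<union> ?U). ?f v)"
    by (rule sum.cong) (auto simp: nontree_def)
  also have "\<dots> = loss q E + (\<Sum>(v, l, u) \<in> ?D \<union> ?U. ?f v)"
    unfolding loss_def using assms(2)
    by (intro sum.union_disjoint) (auto simp: nontree_def intro: finite_subset[OF _ assms(2)])
  also have "(\<Sum>(v, l, u) \<in> ?D \<union> ?U. ?f v) = (\<Sum>(v, l, u) \<in> ?D. ?f v) + (\<Sum>(v, l, u) \<in> ?U. ?f v)"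
    using assms(2) by (intro sum.union_disjoint) (auto intro: finite_subset[OF _ assms(2)])
  also have "(\<Sum>(v, l, u) \<in> ?D. ?f v) = (\<Sum>u \<in> ?V - {[]}. q * ?f u)"
  proof (rule sum.reindex_bij_witness[of _ "\<lambda>u. (butlast u, last u, u)" "\<lambda>(v, l, u). u"])
    fix u assume u: "u \<in> ?V - {[]}"
    then show "(butlast u, last u, u) \<in> ?D"
      using verts_snoc[OF assms(1), of "butlast u" "last u"] by auto
  next
    fix e assume "e \<in> ?D"
    then obtain v l where e: "e = (v, l, v @ [l])" "(v, l, v @ [l]) \<in> E" by auto
    then show "(case e of (v, l, u) \<Rightarrow> u) \<in> ?V - {[]}" using verts_target[OF assms(1)] by auto
    show "q * ?f (case e of (v, l, u) \<Rightarrow> u) = (case e of (v, l, u) \<Rightarrow> ?f v)"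
      using e assms(5) by simp
  qed auto
  also have "(\<Sum>(v, l, u) \<in> ?U. ?f v) = (\<Sum>v \<in> ?V - {[]}. ?f v)"
  proof (rule sum.reindex_bij_witness[of _ "\<lambda>v. (v, linv (last v), butlast v)" "\<lambda>(v, l, u). v"])
    fix u assume u: "u \<in> ?V - {[]}"
    then show "(u, linv (last u), butlast u) \<in> ?U"
      using verts_snoc[OF assms(1), of "butlast u" "last u"] pgraph_sym[OF assms(1)] by auto
  qed (auto dest: verts_source)
  also have "(\<Sum>u \<in> ?V - {[]}. q * ?f u) + (\<Sum>v \<in> ?V - {[]}. ?f v)
      = 2 * real (card B) * (\<Sum>v \<in> ?V - {[]}. ?f v)"
    unfolding assms(4) sum_distrib_left[symmetric] by (simp add: algebra_simps)
  also have "(\<Sum>v \<in> ?V - {[]}. ?f v) = sum ?f ?V - 1"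
    using fV by (simp add: sum_diff1)
  finally show ?thesis by (simp add: algebra_simps)
qed

lemma stubs_nonempty:
  assumes "pgraph B E" "finite E" "finite B" "q = 2 * real (card B) - 1" "q > 0"
    "loss q E < 2 * real (card B)"
  shows "stubs B E \<noteq> {}"
  using loss_identity[OF assms(1-5)] assms(6) by auto

subsection \<open>Attaching a segment\<close>

fun hang :: "(bool \<times> 'a) list \<Rightarrow> (bool \<times> 'a) list \<Rightarrow>
    ((bool \<times> 'a) list \<times> (bool \<times> 'a) \<times> (bool \<times> 'a) list) set" where
  "hang y [] = {}"
| "hang y (l # w) = arcs y l (y @ [l]) \<union> hang (y @ [l]) w"

lemma finite_hang: "finite (hang y w)"
  by (induction w arbitrary: y) (auto simp: arcs_def)

lemma nontree_hang: "nontree (E \<union> hang y w) = nontree E"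
proof (induction w arbitrary: E y)
  case (Cons l w)
  have "E \<union> hang y (l # w) = (E \<union> arcs y l (y @ [l])) \<union> hang (y @ [l]) w" by auto
  then show ?case using Cons nontree_expand by metis
qed simp

lemma hang_length: "(s, m, t) \<in> hang y w \<Longrightarrow> length y \<le> length s"
  by (induction w arbitrary: y) (fastforce simp: arcs_def)+

lemma hang_start: "(y, m, t) \<in> hang y w \<Longrightarrow> w \<noteq> [] \<and> m = hd w"
  by (cases w) (auto simp: arcs_def dest: hang_length)

lemma path_hang: "path (hang y w) y w (y @ w)"
proof (induction w arbitrary: y)
  case (Cons l w)
  have "path (hang y (l # w)) (y @ [l]) w ((y @ [l]) @ w)"
    by (rule path_mono[OF Cons]) auto
  then show ?case by (auto simp: arcs_def)
qed simp

lemma stubs_expand: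
  assumes "pgraph B E" "(y, l) \<in> stubs B E" "m \<noteq> linv l" "snd m \<in> B"
  shows "(y @ [l], m) \<in> stubs B (E \<union> arcs y l (y @ [l]))"
proof -
  have "(y @ [l], m, u) \<notin> E" for u using stubs_snoc[OF assms(1,2)] verts_source by metis
  then show ?thesis using assms by (auto simp: stubs_def verts_def arcs_def)
qed

text \<open>A fresh segment has no branches: its tip has only the edge back, and a reduced path
  coming from an old vertex cannot turn round inside, so it reads all of \<open>w\<close> before the
  tip. Both facts serve to show that tips stay free for joining.\<close>

lemma hang_props:
  assumes "pgraph B E" "w \<noteq> []" "(y, hd w) \<in> stubs B E" "red w" "w \<in> words B"
  shows "pgraph B (E \<union> hang y w)"
    and "(y @ w, m, t) \<in> E \<union> hang y w \<Longrightarrow> m = linv (last w)"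
    and "\<lbrakk>path (E \<union> hang y w) v u (y @ w); v \<in> verts E; red u\<rbrakk> \<Longrightarrow> \<exists>u'. u = u' @ w"
proof -
  have "pgraph B (E \<union> hang y w) \<and> (\<forall>m t. (y @ w, m, t) \<in> E \<union> hang y w \<longrightarrow> m = linv (last w))
     \<and> (\<forall>v u. path (E \<union> hang y w) v u (y @ w) \<longrightarrow> v \<in> verts E \<longrightarrow> red u \<longrightarrow> (\<exists>u'. u = u' @ w))"
    using assms
  proof (induction w arbitrary: E y)
    case (Cons l w)
    let ?E = "E \<union> arcs y l (y @ [l])" and ?E' = "E \<union> hang y (l # w)"
    have st: "(y, l) \<in> stubs B E" using Cons.prems by simp
    have E': "?E' = ?E \<union> hang (y @ [l]) w" by auto
    have pg: "pgraph B ?E" using pgraph_expand[OF Cons.prems(1) st] .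
    have new: "(y @ [l], m, u) \<notin> E" for m u
      using stubs_snoc[OF Cons.prems(1) st] verts_source by metis
    have IH: "pgraph B ?E'" "\<And>m t. (y @ l # w, m, t) \<in> ?E' \<Longrightarrow> m = linv (last w)"
      "\<And>v u. path ?E' v u (y @ l # w) \<Longrightarrow> v \<in> verts ?E \<Longrightarrow> red u \<Longrightarrow> (\<exists>u'. u = u' @ w)"
      if "w \<noteq> []"
    proof -
      have "(y @ [l], hd w) \<in> stubs B ?E"
        using Cons.prems that by (intro stubs_expand st) (cases w; auto)+
      with Cons.IH[OF pg that] Cons.prems
      have "pgraph B (?E \<union> hang (y @ [l]) w)"
        "\<forall>m t. (y @ [l] @ w, m, t) \<in> ?E \<union> hang (y @ [l]) w \<longrightarrow> m = linv (last w)"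
        "\<forall>v u. path (?E \<union> hang (y @ [l]) w) v u (y @ [l] @ w) \<longrightarrow> v \<in> verts ?E \<longrightarrow> red u
           \<longrightarrow> (\<exists>u'. u = u' @ w)"
        by (auto simp: successively_Cons)
      then show "pgraph B ?E'" "\<And>m t. (y @ l # w, m, t) \<in> ?E' \<Longrightarrow> m = linv (last w)"
        "\<And>v u. path ?E' v u (y @ l # w) \<Longrightarrow> v \<in> verts ?E \<Longrightarrow> red u \<Longrightarrow> (\<exists>u'. u = u' @ w)"
        unfolding E' by auto
    qed
    have pg': "pgraph B ?E'" using pg IH(1) by (cases "w = []") auto
    have edge: "m = linv l \<or> (w \<noteq> [] \<and> m = hd w)" if "(y @ [l], m, t) \<in> ?E'" for m t
      using that by (auto simp: arcs_def new dest: hang_start)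
    show ?case
    proof (intro conjI allI impI)
      show "pgraph B ?E'" by (rule pg')
      fix m t assume "(y @ l # w, m, t) \<in> ?E'"
      then show "m = linv (last (l # w))" using IH(2) edge by (cases "w = []") auto
    next
      fix v u assume u: "path ?E' v u (y @ l # w)" "v \<in> verts E" "red u"
      have "v \<in> verts ?E" using u(2) verts_mono[of E ?E] by auto
      then obtain u' where u': "u = u' @ w" using IH(3) u by (cases "w = []") auto
      then obtain z where z: "path ?E' v u' z" "path ?E' z w (y @ l # w)"
        using u by (auto simp: path_append)
      have "path ?E' (y @ [l]) w ((y @ [l]) @ w)"
        unfolding E' by (rule path_mono[OF path_hang]) auto
      then have "z = y @ [l]"
        using path_inj[OF pgraph_inv_graph[OF pg'] z(2)] by simp
      with z have z': "path ?E' v u' (y @ [l])" by simp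
      have "v \<noteq> y @ [l]" using u(2) stubs_snoc[OF Cons.prems(1) st] by auto
      then obtain u'' m where u'': "u' = u'' @ [m]" using z' by (cases u' rule: rev_exhaust) auto
      with z' obtain s where "(s, m, y @ [l]) \<in> ?E'" by (auto simp: path_append)
      then have "(y @ [l], linv m, s) \<in> ?E'" by (rule pgraph_sym[OF pg'])
      \<comment> \<open>The alternative \<open>hd w = linv m\<close> would mean arriving from
        further out on the segment and turning back at once, which a reduced word cannot do.\<close>
      from edge[OF this] have "m = l \<or> w \<noteq> [] \<and> hd w = linv m" by auto
      moreover have "\<not> (w \<noteq> [] \<and> hd w = linv m)"
        using u(3) u' u'' by (auto simp: successively_append_iff successively_Cons)
      ultimately show "\<exists>u'. u = u' @ l # w" using u' u'' by auto
    qed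
  qed simp
  then show "pgraph B (E \<union> hang y w)"
    and "(y @ w, m, t) \<in> E \<union> hang y w \<Longrightarrow> m = linv (last w)"
    and "\<lbrakk>path (E \<union> hang y w) v u (y @ w); v \<in> verts E; red u\<rbrakk> \<Longrightarrow> \<exists>u'. u = u' @ w"
    by blast+
qed

lemma path_leaves_at_stub:
  assumes "pgraph B E" "v \<in> verts E" "w \<in> words B" "\<nexists>u. path E v w u"
  obtains w1 w2 y where "w = w1 @ w2" "path E v w1 y" "w2 \<noteq> []" "(y, hd w2) \<in> stubs B E"
proof -
  have "\<exists>w1 w2 y. w = w1 @ w2 \<and> path E v w1 y \<and> w2 \<noteq> [] \<and> (y, hd w2) \<in> stubs B E"
    using assms(2-)
  proof (induction w arbitrary: v)
    case (Cons l w)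
    show ?case
    proof (cases "\<exists>u. (v, l, u) \<in> E")
      case True
      then obtain u where u: "(v, l, u) \<in> E" by blast
      then have "u \<in> verts E" by (rule verts_target[OF assms(1)])
      moreover have "w \<in> words B" "\<nexists>t. path E u w t" using u Cons.prems by auto
      ultimately obtain w1 w2 y where
        "w = w1 @ w2" "path E u w1 y" "w2 \<noteq> []" "(y, hd w2) \<in> stubs B E"
        using Cons.IH by blast
      then show ?thesis using u by (intro exI[of _ "l # w1"] exI[of _ w2] exI[of _ y]) auto
    next
      case False
      then show ?thesis using Cons.prems
        by (intro exI[of _ "[]"] exI[of _ "l # w"] exI[of _ v]) (auto simp: stubs_def)
    qed
  qed simp
  then show ?thesis using that by blast
qed

lemma path_total:
  assumes "pgraph B E" "stubs B E = {}" "v \<in> verts E" "w \<in> words B"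
  shows "\<exists>u. path E v w u"
proof (rule ccontr)
  assume no: "\<not> ?thesis"
  show False by (rule path_leaves_at_stub[OF assms(1,3,4) no]) (simp add: assms(2))
qed

section \<open>Extending finite graphs\<close>

lemma red_append: "red (u @ w) \<Longrightarrow> red u \<and> red w"
  by (simp add: successively_append_iff)

lemma verts_prefix: "pgraph B E \<Longrightarrow> y @ z \<in> verts E \<Longrightarrow> y \<in> verts E"
proof (induction z rule: rev_induct)
  case (snoc l z)
  then show ?case using verts_snoc[of B E "y @ z" l] verts_source by fastforce
qed simp

lemma hang_prefix: "(s, m, t) \<in> hang y w \<Longrightarrow> s = y \<or> (\<exists>z. s = y @ hd w # z)"
proof (induction w arbitrary: y)
  case (Cons l w)
  then show ?case by (fastforce simp: arcs_def)
qed simp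

lemma hang_new:
  assumes "pgraph B E" "(y, hd w) \<in> stubs B E" "(s, m, t) \<in> hang y w"
  shows "s = y \<or> s \<notin> verts E"
proof -
  have "y @ [hd w] \<notin> verts E" using stubs_snoc assms by metis
  then have "y @ hd w # z \<notin> verts E" for z
    using verts_prefix[OF assms(1), of "y @ [hd w]" z] by auto
  then show ?thesis using hang_prefix[OF assms(3)] by auto
qed

section \<open>Extensions by positive words\<close>

text \<open>Records which letters stay free: in a graph with inverse edges, no old vertex gains an
  incoming generator edge, and generators outside \<open>X\<close> gain no edge at all.\<close>

definition pos_ext :: "'a set \<Rightarrow>
    ((bool \<times> 'a) list \<times> (bool \<times> 'a) \<times> (bool \<times> 'a) list) set \<Rightarrow>
    ((bool \<times> 'a) list \<times> (bool \<times> 'a) \<times> (bool \<times> 'a) list) set \<Rightarrow> bool" where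
  "pos_ext X E E' \<longleftrightarrow> E \<subseteq> E' \<and>
     (\<forall>v l u. (v, l, u) \<in> E' - E \<longrightarrow> fst l \<longrightarrow> snd l \<in> X \<and> u = v @ [l] \<and> u \<notin> verts E)"

abbreviation positive :: "(bool \<times> 'a) list \<Rightarrow> bool" where
  "positive w \<equiv> \<forall>l \<in> set w. fst l"

lemma pos_ext_refl: "pos_ext X E E"
  by (auto simp: pos_ext_def)

lemma pos_ext_subset: "pos_ext X E E' \<Longrightarrow> E \<subseteq> E'"
  by (simp add: pos_ext_def)

lemma pos_ext_edge:
  "pos_ext X E E' \<Longrightarrow> (v, l, u) \<in> E' \<Longrightarrow> (v, l, u) \<notin> E \<Longrightarrow> fst l \<Longrightarrow>
   snd l \<in> X \<and> u = v @ [l] \<and> u \<notin> verts E"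
  unfolding pos_ext_def by blast

lemma pos_ext_trans:
  assumes "pos_ext X E E'" "pos_ext Y E' E''" "X \<subseteq> Z" "Y \<subseteq> Z"
  shows "pos_ext Z E E''"
  unfolding pos_ext_def
proof (intro conjI allI impI)
  show "E \<subseteq> E''" using pos_ext_subset[OF assms(1)] pos_ext_subset[OF assms(2)] by (rule subset_trans)
  fix v l u assume *: "(v, l, u) \<in> E'' - E" "fst l"
  have "(snd l \<in> X \<or> snd l \<in> Y) \<and> u = v @ [l] \<and> u \<notin> verts E"
  proof (cases "(v, l, u) \<in> E'")
    case True
    then show ?thesis using pos_ext_edge[OF assms(1)] * by blast
  next
    case False
    then show ?thesis using pos_ext_edge[OF assms(2)] * verts_mono[OF pos_ext_subset[OF assms(1)]]
      by blast
  qed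
  then show "snd l \<in> Z" "u = v @ [l]" "u \<notin> verts E" using assms(3,4) by auto
qed

text \<open>Every edge leaving a vertex outside \<open>verts E\<close> is new, and a new positive
  edge is a tree edge, so the word is appended to the name and the path never comes back.\<close>

lemma pos_ext_outside:
  assumes "pos_ext X E E'" "s \<notin> verts E" "path E' s w p" "positive w"
  shows "p = s @ w \<and> p \<notin> verts E"
  using assms(2-)
proof (induction w arbitrary: s)
  case (Cons l w)
  then obtain t where t: "(s, l, t) \<in> E'" "path E' t w p" by auto
  have "(s, l, t) \<notin> E" using Cons.prems(1) verts_source by metis
  then have "t = s @ [l]" "t \<notin> verts E" using pos_ext_edge[OF assms(1) t(1)] Cons.prems by auto
  with Cons.IH[OF _ t(2)] Cons.prems show ?case by auto
qed simp

lemma pos_ext_leave: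
  assumes "pos_ext X E E'" "path E' v w p" "positive w" "\<nexists>u. path E v w u"
  shows "p \<notin> verts E"
  using assms(2-)
proof (induction w arbitrary: v)
  case (Cons l w)
  then obtain t where t: "(v, l, t) \<in> E'" "path E' t w p" by auto
  show ?case
  proof (cases "(v, l, t) \<in> E")
    case True
    then show ?thesis using Cons.IH[OF t(2)] Cons.prems by auto
  next
    case False
    then have "t \<notin> verts E" using pos_ext_edge[OF assms(1) t(1)] Cons.prems by auto
    then show ?thesis using pos_ext_outside[OF assms(1) _ t(2)] Cons.prems by auto
  qed
qed simp

lemma pos_ext_expand:
  assumes "pgraph B E" "(v, l) \<in> stubs B E" "fst l" "snd l \<in> X"
  shows "pos_ext X E (E \<union> arcs v l (v @ [l]))"
  using assms stubs_snoc[OF assms(1,2)] by (auto simp: pos_ext_def arcs_def linv_def)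

lemma pos_extend1:
  assumes "pgraph B E" "finite E" "v \<in> verts E" "w \<in> words X" "X \<subseteq> B" "positive w"
  shows "\<exists>E'. pgraph B E' \<and> finite E' \<and> nontree E' = nontree E \<and> pos_ext X E E' \<and>
           (\<exists>p. path E' v w p)"
  using assms
proof (induction w arbitrary: E v)
  case Nil
  then show ?case using pos_ext_refl by fastforce
next
  case (Cons l w)
  have "\<exists>E1 t. pgraph B E1 \<and> finite E1 \<and> nontree E1 = nontree E \<and> pos_ext X E E1 \<and> (v, l, t) \<in> E1"
  proof (cases "\<exists>t. (v, l, t) \<in> E")
    case True
    then show ?thesis using Cons.prems pos_ext_refl by metis
  next
    case False
    then have st: "(v, l) \<in> stubs B E" using Cons.prems by (auto simp: stubs_def)
    show ?thesis
      using pgraph_expand[OF Cons.prems(1) st] nontree_expand[of E v l] Cons.prems(2)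
        pos_ext_expand[OF Cons.prems(1) st] Cons.prems(4,6)
      by (intro exI[of _ "E \<union> arcs v l (v @ [l])"] exI[of _ "v @ [l]"]) (auto simp: arcs_def)
  qed
  then obtain E1 t where E1: "pgraph B E1" "finite E1" "nontree E1 = nontree E"
    "pos_ext X E E1" "(v, l, t) \<in> E1" by blast
  have "t \<in> verts E1" using verts_target E1 by metis
  moreover have "w \<in> words X" "positive w" using Cons.prems by auto
  ultimately obtain E' p where E': "pgraph B E'" "finite E'" "nontree E' = nontree E1"
    "pos_ext X E1 E'" "path E' t w p"
    using Cons.IH[OF E1(1,2) _ _ Cons.prems(5)] by blast
  have "path E' v (l # w) p" using E1(5) E'(5) pos_ext_subset[OF E'(4)] by auto
  then show ?case using E' E1 pos_ext_trans[OF E1(4) E'(4)] by auto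
qed

lemma pos_extend:
  assumes "pgraph B E" "finite E" "w \<in> words X" "X \<subseteq> B" "positive w" "finite S" "S \<subseteq> verts E"
  obtains E' where "pgraph B E'" "finite E'" "nontree E' = nontree E" "pos_ext X E E'"
    "\<And>v. v \<in> S \<Longrightarrow> \<exists>p. path E' v w p"
proof -
  have "\<exists>E'. pgraph B E' \<and> finite E' \<and> nontree E' = nontree E \<and> pos_ext X E E' \<and>
      (\<forall>v \<in> S. \<exists>p. path E' v w p)"
    using assms(6,7)
  proof (induction S rule: finite_induct)
    case empty
    then show ?case using assms pos_ext_refl by blast
  next
    case (insert v S)
    then obtain E1 where E1: "pgraph B E1" "finite E1" "nontree E1 = nontree E" "pos_ext X E E1"
      "\<And>v. v \<in> S \<Longrightarrow> \<exists>p. path E1 v w p" by auto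
    have "v \<in> verts E1" using insert.prems verts_mono[OF pos_ext_subset[OF E1(4)]] by auto
    from pos_extend1[OF E1(1,2) this assms(3-5)] obtain E' where E': "pgraph B E'" "finite E'"
      "nontree E' = nontree E1" "pos_ext X E1 E'" "\<exists>p. path E' v w p" by blast
    have "\<exists>p. path E' u w p" if "u \<in> S" for u
      using E1(5)[OF that] path_mono[OF _ pos_ext_subset[OF E'(4)]] by blast
    then show ?case using E' E1 pos_ext_trans[OF E1(4) E'(4)] by auto
  qed
  then show ?thesis using that by blast
qed

text \<open>
  Otherwise the vertices reachable by positive words form a finite set on which every generator
  acts injectively, hence bijectively, so that the graph has no stubs.
\<close>

lemma positive_word_leaves:
  assumes "pgraph B E" "finite E" "stubs B E \<noteq> {}" "v \<in> verts E"
  shows "\<exists>w \<in> words B. positive w \<and> (\<nexists>u. path E v w u)"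
proof (rule ccontr)
  assume "\<not> ?thesis"
  then have all: "\<exists>u. path E v w u" if "w \<in> words B" "positive w" for w using that by blast
  define R where "R = {u. \<exists>w \<in> words B. positive w \<and> path E v w u}"
  have RV: "R \<subseteq> verts E" unfolding R_def using path_verts assms by blast
  then have fR: "finite R" using finite_verts[OF assms(2)] finite_subset by blast
  have fwd: "\<exists>t \<in> R. (u, (True, b), t) \<in> E" if u: "u \<in> R" and b: "b \<in> B" for u b
  proof -
    from u obtain w where w: "w \<in> words B" "positive w" "path E v w u" unfolding R_def by blast
    then obtain t where t: "path E v (w @ [(True, b)]) t" using all[of "w @ [(True, b)]"] b by auto
    then have "(u, (True, b), t) \<in> E"
      using path_det[OF pgraph_inv_graph[OF assms(1)] w(3)] by (auto simp: path_append)
    moreover have "t \<in> R" unfolding R_def using w b t by (intro CollectI bexI[of _ "w @ [(True, b)]"]) auto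
    ultimately show ?thesis by blast
  qed
  have bwd: "\<exists>t \<in> R. (u, (False, b), t) \<in> E" if u: "u \<in> R" and b: "b \<in> B" for u b
  proof -
    have "\<forall>u \<in> R. \<exists>t. t \<in> R \<and> (u, (True, b), t) \<in> E" using fwd b by blast
    from bchoice[OF this] obtain f where
      f: "\<And>u. u \<in> R \<Longrightarrow> f u \<in> R \<and> (u, (True, b), f u) \<in> E" by blast
    have inj: "inj_on f R"
    proof (rule inj_onI)
      fix s t assume "s \<in> R" "t \<in> R" "f s = f t"
      then show "s = t"
        using f[of s] f[of t] inv_graph_inj[OF pgraph_inv_graph[OF assms(1)], of s "(True, b)"] by simp
    qed
    have "f ` R \<subseteq> R" by (rule image_subsetI) (rule conjunct1[OF f])
    then have "u \<in> f ` R" using endo_inj_surj[OF fR _ inj] u by simp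
    then obtain t where "t \<in> R" "f t = u" by (elim imageE) simp
    moreover from this have "(t, (True, b), u) \<in> E" using f[of t] by blast
    from pgraph_sym[OF assms(1) this] have "(u, (False, b), t) \<in> E" by simp
    ultimately show ?thesis by blast
  qed
  have step: "\<exists>t \<in> R. (u, l, t) \<in> E" if "u \<in> R" "snd l \<in> B" for u l
  proof -
    obtain i b where l: "l = (i, b)" by (cases l)
    show ?thesis using fwd[of u b] bwd[of u b] that unfolding l by (cases i) simp_all
  qed
  have closed: "u \<in> R \<Longrightarrow> path E u w t \<Longrightarrow> t \<in> R" for u w t
  proof (induction w arbitrary: u)
    case (Cons l w)
    then obtain s where s: "(u, l, s) \<in> E" "path E s w t" by auto
    then have "s \<in> R" using step[OF Cons.prems(1), of l] pgraph_letter[OF assms(1) s(1)]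
        pgraph_det[OF assms(1) s(1)] by blast
    then show ?case using Cons.IH s by blast
  qed simp
  have "v \<in> R" unfolding R_def by (intro CollectI bexI[of _ "[]"]) auto
  then have "[] \<in> R"
    using closed path_winv[OF pgraph_inv_graph[OF assms(1)] path_to_vert[OF assms(1,4)]] by blast
  then have "verts E \<subseteq> R" using closed path_to_vert[OF assms(1)] by blast
  then have "stubs B E = {}" using step unfolding stubs_def by blast
  then show False using assms(3) by simp
qed

text \<open>Vertices are driven out one by one: a word that fails at a vertex still fails there when
  prolonged, so it suffices to append a leaving word for the place that the next vertex has
  reached.\<close>

lemma positive_word_leaves_all:
  assumes "pgraph B E" "finite E" "stubs B E \<noteq> {}"
  obtains w where "w \<in> words B" "positive w" "\<And>v. v \<in> verts E \<Longrightarrow> \<nexists>u. path E v w u"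
proof -
  have "\<exists>w \<in> words B. positive w \<and> (\<forall>v \<in> S. \<nexists>u. path E v w u)"
    if "finite S" "S \<subseteq> verts E" for S
    using that
  proof (induction S rule: finite_induct)
    case empty
    show ?case by (rule bexI[of _ "[]"]) auto
  next
    case (insert v S)
    then obtain w where w: "w \<in> words B" "positive w" "\<forall>v \<in> S. \<nexists>u. path E v w u" by auto
    show ?case
    proof (cases "\<exists>u. path E v w u")
      case True
      then obtain u where u: "path E v w u" by blast
      then have "u \<in> verts E" using path_verts assms insert.prems by blast
      then obtain w' where w': "w' \<in> words B" "positive w'" "\<nexists>t. path E u w' t"
        using positive_word_leaves[OF assms] by blast
      have "\<nexists>t. path E v (w @ w') t"
        using w'(3) path_det[OF pgraph_inv_graph[OF assms(1)] u] by (auto simp: path_append)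
      moreover have "\<forall>v \<in> S. \<nexists>t. path E v (w @ w') t" using w(3) by (auto simp: path_append)
      ultimately show ?thesis using w w' by (intro bexI[of _ "w @ w'"]) auto
    qed (use w in auto)
  qed
  from this[OF finite_verts[OF assms(2)]] show ?thesis using that by blast
qed

section \<open>The weight budget and the two finite steps\<close>

locale labels =
  fixes B :: "'a set" and bound :: real
  assumes finB: "finite B" and card_gt: "card B > 1" and bound: "bound < 2 * real (card B)"
begin

abbreviation q :: real where "q \<equiv> 2 * real (card B) - 1"

lemma q_gt: "q > 1"
  using card_gt by linarith

text \<open>Strictness matters: \<open>bound - loss q E\<close> is the positive slack that the next
  joining may spend. The gap between \<open>bound\<close> and \<open>2 * card B\<close> is never
  touched.\<close>

definition good :: "((bool \<times> 'a) list \<times> (bool \<times> 'a) \<times> (bool \<times> 'a) list) set \<Rightarrow> bool" where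
  "good E \<longleftrightarrow> pgraph B E \<and> finite E \<and> loss q E < bound"

lemma good_stubs: "good E \<Longrightarrow> stubs B E \<noteq> {}"
  using stubs_nonempty[OF _ _ finB refl] q_gt bound by (auto simp: good_def)

lemma small_power:
  assumes "e > 0"
  shows "\<exists>n. 2 * real k / q ^ n < e"
proof -
  \<comment> \<open>The summand \<open>1\<close> keeps the denominator positive for
    \<open>k = 0\<close>, the case of empty tuples.\<close>
  obtain n where n: "(1 / q) ^ n < e / (2 * real k + 1)"
    using real_arch_pow_inv[of "e / (2 * real k + 1)" "1 / q"] assms q_gt by auto
  have "2 * real k / q ^ n \<le> (2 * real k + 1) * (1 / q) ^ n"
    using q_gt by (simp add: power_one_over field_simps)
  also have "\<dots> < e" using n by (simp add: field_simps)
  finally show ?thesis by blast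
qed

lemma good_connect:
  assumes "good E" "\<And>p. p \<in> dom \<tau> \<Longrightarrow> (p, l) \<in> stubs B E"
    "\<And>p p'. \<tau> p = Some p' \<Longrightarrow> (p', linv l) \<in> stubs B E" "inj_on \<tau> (dom \<tau>)"
    "finite (dom \<tau>)" "card (dom \<tau>) \<le> k" "2 * real k / q ^ N < bound - loss q E"
    "\<And>p p'. \<tau> p = Some p' \<Longrightarrow> length p \<ge> N \<and> length p' \<ge> N"
  obtains E' where "good E'" "E \<subseteq> E'" "\<And>p p'. \<tau> p = Some p' \<Longrightarrow> (p, l, p') \<in> E'"
proof
  let ?E' = "E \<union> {(p, l, p') |p p'. \<tau> p = Some p'} \<union> {(p', linv l, p) |p p'. \<tau> p = Some p'}"
  have E: "pgraph B E" "finite E" using assms(1) by (auto simp: good_def)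
  have "q \<ge> 1" using q_gt by simp
  show "good ?E'"
    unfolding good_def
    using pgraph_connect(1)[OF E(1) assms(2-4)] loss_connect[OF E(2) assms(5,6) \<open>q \<ge> 1\<close> assms(8), of l]
      assms(7) by auto
qed auto

text \<open>
  The orbit of \<open>v\<close> under \<open>c\<close> is prolonged by fresh segments \<open>W\<close> forwards and \<open>U\<close> backwards,
  whose ends are then joined.  The backward path cannot run to the end of \<open>W\<close>: it would read all of
  \<open>W\<close>, which contains \<open>c\<close>, so that \<open>c\<close> would be a rotation of its own inverse.
\<close>

lemma burnside_step:
  assumes "good E" "v \<in> verts E" "c \<in> words B" "cyc_red c"
  shows "\<exists>E' n. good E' \<and> E \<subseteq> E' \<and> n > 0 \<and> path E' v (wpow c n) v"
proof (cases "\<exists>n > 0. path E v (wpow c n) v")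
  case True
  then show ?thesis using assms(1) by blast
next
  case False
  have E: "pgraph B E" "finite E" "loss q E < bound" using assms(1) by (auto simp: good_def)
  obtain N where N: "\<nexists>u. path E v (wpow c N) u"
    using path_wpow_total[OF pgraph_inv_graph[OF E(1)] finite_verts[OF E(2)], of v c] False
      path_verts[OF E(1) _ assms(2)] by metis
  obtain K0 where K0: "2 * real 1 / q ^ K0 < bound - loss q E"
    using small_power[of "bound - loss q E" 1] E(3) by auto
  \<comment> \<open>\<open>K0\<close> periods give the required depth. The extra one makes
    \<open>W\<close> contain a full copy of \<open>c\<close> and \<open>U\<close> end in a full copy
    of \<open>winv c\<close>.\<close>
  define K where "K = Suc K0"
  have K: "2 * real 1 / q ^ K0 < bound - loss q E" "K \<ge> K0" using K0 by (auto simp: K_def)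
  \<comment> \<open>The last letter \<open>x\<close> of a period is set aside as the label of the
    edge that will join the two ends.\<close>
  obtain c1 x where c: "c = c1 @ [x]" using assms(4) by (metis cyc_red_def rev_exhaust)
  let ?c' = "winv c"
  have c': "?c' \<in> words B" "cyc_red ?c'" using assms cyc_red_winv by auto
  obtain w1 w2 y where w: "wpow c N = w1 @ w2" "path E v w1 y" "w2 \<noteq> []" "(y, hd w2) \<in> stubs B E"
    using path_leaves_at_stub[OF E(1) assms(2) wpow_words[OF assms(3)] N] by metis
  define W where "W = w2 @ wpow c K @ c1"
  have pw: "wpow c (N + K + 1) = w1 @ W @ [x]"
    using wpow_add[of c "N + K" 1] wpow_add[of c N K] w(1) c by (simp add: W_def)
  have "red (w1 @ W @ [x])" "w1 @ W @ [x] \<in> words B"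
    unfolding pw[symmetric] using red_wpow[OF assms(4)] wpow_words[OF assms(3)] by blast+
  then have W: "W \<noteq> []" "hd W = hd w2" "red (W @ [x])" "red W" "W \<in> words B"
    using w(3) red_append[of w1 "W @ [x]"] red_append[of W "[x]"] by (auto simp: W_def)
  let ?E1 = "E \<union> hang y W"
  let ?p = "y @ W"
  note hp = hang_props[OF E(1) W(1) _ W(4,5), of y, unfolded W(2), OF w(4)]
  have E1: "pgraph B ?E1" "finite ?E1" "nontree ?E1 = nontree E"
    by (simp_all add: hp(1) E(2) finite_hang nontree_hang)
  have good1: "good ?E1" using E E1 by (simp add: good_def loss_def)
  have v1: "v \<in> verts ?E1" using assms(2) verts_mono[of E ?E1] by auto
  have pathp: "path ?E1 v (w1 @ W) ?p"
    using path_mono[OF w(2), of ?E1] path_mono[OF path_hang, of y W ?E1] by (auto simp: path_append)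
  have p1: "?p \<in> verts ?E1" using path_verts[OF E1(1) pathp v1] .
  show ?thesis
  proof (cases "\<exists>n > 0. path ?E1 v (wpow ?c' n) v")
    case True
    then obtain n where "n > 0" "path ?E1 v (winv (wpow ?c' n)) v"
      using path_winv[OF pgraph_inv_graph[OF E1(1)]] by blast
    then show ?thesis using good1 by (intro exI[of _ ?E1] exI[of _ n]) (auto simp: winv_wpow)
  next
    case False
    obtain M where M: "\<nexists>u. path ?E1 v (wpow ?c' M) u"
      using path_wpow_total[OF pgraph_inv_graph[OF E1(1)] finite_verts[OF E1(2)], of v ?c'] False
        path_verts[OF E1(1) _ v1] by metis
    obtain u1 u2 z where u: "wpow ?c' M = u1 @ u2" "path ?E1 v u1 z" "u2 \<noteq> []"
      "(z, hd u2) \<in> stubs B ?E1"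
      using path_leaves_at_stub[OF E1(1) v1 wpow_words[OF c'(1)] M] by metis
    define U where "U = u2 @ wpow ?c' K"
    have pu: "wpow ?c' (M + K) = u1 @ U" using u(1) by (simp add: U_def wpow_add)
    have "red (u1 @ U)" "u1 @ U \<in> words B"
      unfolding pu[symmetric] using red_wpow[OF c'(2)] wpow_words[OF c'(1)] by blast+
    then have U: "U \<noteq> []" "hd U = hd u2" "red U" "U \<in> words B"
      using u(3) by (auto simp: U_def dest: red_append)
    \<comment> \<open>Otherwise the backward segment would start at the forward tip and might occupy
      its letter \<open>x\<close>.\<close>
    have "z \<noteq> ?p"
    proof
      assume "z = ?p"
      then have "path ?E1 v u1 ?p" using u(2) by simp
      moreover have "red u1"
        using red_wpow[OF c'(2), of M] u(1) by (simp add: successively_append_iff)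
      ultimately obtain u' where "u1 = u' @ W" using hp(3)[OF _ assms(2)] by blast
      then have "wpow ?c' M = (u' @ w2) @ c @ (wpow c K0 @ c1 @ u2)"
        using u(1) by (simp add: W_def K_def)
      from factor_of_wpow[OF this] obtain a b where "?c' = a @ b" "c = b @ a" by auto
      then show False using not_rotation_of_winv[OF assms(4)] by blast
    qed
    let ?E2 = "?E1 \<union> hang z U"
    let ?r = "z @ U"
    have zU: "(z, hd U) \<in> stubs B ?E1" using u(4) U(2) by simp
    note hr = hang_props[OF E1(1) U(1) zU U(3,4)]
    have E2: "pgraph B ?E2" "finite ?E2" "nontree ?E2 = nontree E"
      by (simp_all only: hr(1) finite_Un E(2) simp_thms finite_hang nontree_hang)
    have good2: "good ?E2" using E E2 by (simp add: good_def loss_def)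
    have v2: "v \<in> verts ?E2" using v1 verts_mono[of ?E1 ?E2] by auto
    have pathr: "path ?E2 v (wpow ?c' (M + K)) ?r"
      unfolding pu using path_mono[OF u(2), of ?E2] path_mono[OF path_hang, of z U ?E2]
      by (auto simp: path_append)
    have r2: "?r \<in> verts ?E2" using path_verts[OF E2(1) pathr v2] .
    have p2: "?p \<in> verts ?E2" using p1 verts_mono[of ?E1 ?E2] by auto
    have xB: "snd x \<in> B" using assms(3) c by simp
    have st1: "(?p, x) \<in> stubs B ?E2"
    proof -
      have "(?p, x, t) \<notin> ?E2" for t
      proof
        assume "(?p, x, t) \<in> ?E2"
        then have "(?p, x, t) \<in> ?E1"
          using hang_new[OF E1(1) zU] p1 \<open>z \<noteq> ?p\<close> by blast
        from hp(2)[OF this] show False using W(1,3) by (auto simp: successively_append_iff)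
      qed
      then show ?thesis using p2 xB by (auto simp: stubs_def)
    qed
    have st2: "(?r, linv x) \<in> stubs B ?E2"
    proof -
      \<comment> \<open>Hence the only edge at \<open>?r\<close> carries \<open>hd c\<close>, which
        differs from \<open>linv x\<close> because \<open>c\<close> is cyclically reduced.\<close>
      have "last U = linv (hd c)"
        using assms(4) unfolding U_def K_def wpow_Suc'
        by (simp add: cyc_red_def last_append) (simp add: winv_def last_rev hd_map)
      moreover have "linv x \<noteq> hd c" using assms(4) c by (auto simp: cyc_red_def)
      ultimately have "(?r, linv x, t) \<notin> ?E2" for t using hr(2) by fastforce
      then show ?thesis using r2 xB by (auto simp: stubs_def)
    qed
    have len: "length ?p \<ge> K0" "length ?r \<ge> K0"
    proof -
      have "1 \<le> length c" using c by simp
      then have "K * 1 \<le> K * length c" by (rule mult_le_mono2)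
      with K(2) have "K0 \<le> K * length c" by linarith
      then show "length ?p \<ge> K0" "length ?r \<ge> K0" by (auto simp: W_def U_def)
    qed
    have loss2: "loss q ?E2 = loss q E" unfolding loss_def E2(3) ..
    obtain E' where E': "good E'" "?E2 \<subseteq> E'" "(?p, x, ?r) \<in> E'"
    proof (rule good_connect[OF good2, of "[?p \<mapsto> ?r]" x 1 K0])
      show "2 * real 1 / q ^ K0 < bound - loss q ?E2" unfolding loss2 by (rule K(1))
    qed (use st1 st2 len in \<open>auto split: if_splits\<close>)
    have inv: "inv_graph E'" using E'(1) pgraph_inv_graph by (auto simp: good_def)
    have "path E' v (wpow c (N + K + 1)) ?r"
      using path_mono[OF pathp, of E'] E' unfolding pw by (auto simp: path_append)
    moreover have "path E' ?r (wpow c (M + K)) v"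
      using path_winv[OF inv path_mono[OF pathr E'(2)]] by (simp add: winv_wpow)
    ultimately have "path E' v (wpow c ((N + K + 1) + (M + K))) v"
      unfolding wpow_add[of c "N + K + 1"] path_append by blast
    then show ?thesis using E' by (intro exI[of _ E'] exI[of _ "(N + K + 1) + (M + K)"]) auto
  qed
qed

text \<open>
  Both tuples are moved by positive words, and the ends are joined by the generator \<open>a\<close>.  Positive
  words never use up an incoming stub of an old vertex, so the ends reached from \<open>us\<close>, whose
  incoming edges are labelled \<open>b\<close>, can still be entered by \<open>a\<close>.  The tail \<open>rb K2\<close> moves
  the ends reached from \<open>vs\<close> beyond all edges labelled \<open>a\<close>.
\<close>

lemma transitive_step:
  assumes "good E" "distinct vs" "distinct us" "length us = length vs"
    "set vs \<subseteq> verts E" "set us \<subseteq> verts E"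
  shows "\<exists>E' b. good E' \<and> E \<subseteq> E' \<and> b \<in> words B \<and> (\<forall>i < length vs. path E' (vs ! i) b (us ! i))"
proof -
  let ?k = "length vs"
  have E: "pgraph B E" "finite E" "loss q E < bound" using assms(1) by (auto simp: good_def)
  obtain a b where ab: "a \<in> B" "b \<in> B" "a \<noteq> b"
    using card_gt by (metis One_nat_def card_le_Suc0_iff_eq finB linorder_not_less)
  obtain K where K: "2 * real ?k / q ^ K < bound - loss q E"
    using small_power[of "bound - loss q E"] E(3) by auto
  define rb where "rb = (\<lambda>n. replicate n (True, b))"
  have rb: "rb n \<in> words B" "rb n \<in> words {b}" "positive (rb n)" "length (rb n) = n" for n
    using ab by (auto simp: rb_def words_def)

  obtain w0 where w0: "w0 \<in> words B" "positive w0" "\<And>v. v \<in> verts E \<Longrightarrow> \<nexists>u. path E v w0 u"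
    using positive_word_leaves_all[OF E(1,2) good_stubs[OF assms(1)]] by blast
  \<comment> \<open>\<open>w0\<close> brings all of \<open>us\<close> out of \<open>E\<close>; the
    tail then gives depth at least \<open>K\<close>, and \<open>Suc\<close> ensures that the last
    letter is \<open>b\<close> even for \<open>K = 0\<close>.\<close>
  define w' where "w' = w0 @ rb (Suc K)"
  have w': "w' \<in> words B" "positive w'"
    using w0(1,2) rb(1,3)[of "Suc K"] unfolding w'_def words_simps set_append by blast+
  obtain E1 where E1: "pgraph B E1" "finite E1" "nontree E1 = nontree E" "pos_ext B E E1"
    "\<And>v. v \<in> set us \<Longrightarrow> \<exists>p. path E1 v w' p"
    using pos_extend[OF E(1,2) w'(1) order_refl w'(2) finite_set assms(6)] by blast
  have sub1: "E \<subseteq> E1" using pos_ext_subset[OF E1(4)] .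
  from E1(5) obtain P' where P': "\<And>v. v \<in> set us \<Longrightarrow> path E1 v w' (P' v)" by metis
  have P'_new: "\<exists>z. P' v = z @ rb (Suc K) \<and> P' v \<notin> verts E" if v: "v \<in> set us" for v
  proof -
    obtain z where z: "path E1 v w0 z" "path E1 z (rb (Suc K)) (P' v)"
      using P'[OF v] unfolding w'_def path_append by blast
    have "z \<notin> verts E" using pos_ext_leave[OF E1(4) z(1) w0(2)] w0(3) that assms(6) by blast
    with pos_ext_outside[OF E1(4) _ z(2) rb(3)] show ?thesis by blast
  qed
  have P'_verts: "P' v \<in> verts E1" if "v \<in> set us" for v
    using path_verts[OF E1(1) P'[OF that]] that assms(6) verts_mono[OF sub1] by blast
  have P'_stub: "(P' v, (False, a), t) \<notin> E1" if v: "v \<in> set us" for v t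
  proof
    assume "(P' v, (False, a), t) \<in> E1"
    then have t: "(t, (True, a), P' v) \<in> E1" using pgraph_sym[OF E1(1)] by fastforce
    obtain z where z: "P' v = z @ rb (Suc K)" "P' v \<notin> verts E" using P'_new[OF v] by blast
    have "(t, (True, a), P' v) \<notin> E" using verts_target[OF E(1)] z(2) by blast
    then have "P' v = t @ [(True, a)]" using pos_ext_edge[OF E1(4) t] by simp
    then have "last (P' v) = (True, a)" by simp
    moreover have "last (P' v) = (True, b)" using z by (simp add: rb_def)
    ultimately show False using ab by simp
  qed

  have good1: "good E1" using E E1 by (simp add: good_def loss_def)
  \<comment> \<open>Leaving all of \<open>E1\<close>, and not only \<open>E\<close>, ensures that
    the later tail \<open>rb K2\<close> is read along tree edges and really lengthens the
    names.\<close>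
  obtain w1 where w1: "w1 \<in> words B" "positive w1" "\<And>v. v \<in> verts E1 \<Longrightarrow> \<nexists>u. path E1 v w1 u"
    using positive_word_leaves_all[OF E1(1,2) good_stubs[OF good1]] by blast
  have vs1: "set vs \<subseteq> verts E1" using assms(5) verts_mono[OF sub1] by blast
  obtain E2 where E2: "pgraph B E2" "finite E2" "nontree E2 = nontree E1" "pos_ext B E1 E2"
    "\<And>v. v \<in> set vs \<Longrightarrow> \<exists>p. path E2 v w1 p"
    using pos_extend[OF E1(1,2) w1(1) order_refl w1(2) finite_set vs1] by blast
  have sub2: "E1 \<subseteq> E2" using pos_ext_subset[OF E2(4)] .
  from E2(5) obtain Z where Z: "\<And>v. v \<in> set vs \<Longrightarrow> path E2 v w1 (Z v)" by metis
  have Z_new: "Z v \<notin> verts E1" if "v \<in> set vs" for v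
    using pos_ext_leave[OF E2(4) Z[OF that] w1(2)] w1(3) that vs1 by blast
  have Z_verts: "Z ` set vs \<subseteq> verts E2"
    using path_verts[OF E2(1) Z] vs1 verts_mono[OF sub2] by blast

  obtain M where M: "\<And>v. v \<in> verts E2 \<Longrightarrow> length v < M"
    using finite_imageI[OF finite_verts[OF E2(2)], of length]
    unfolding finite_nat_set_iff_bounded by blast
  \<comment> \<open>Length \<open>K\<close> pays for the joining edges; length \<open>M\<close> puts
    the ends outside \<open>E2\<close>, where the last extension adds only edges labelled
    \<open>b\<close>.\<close>
  define K2 where "K2 = max K M"
  obtain E3 where E3: "pgraph B E3" "finite E3" "nontree E3 = nontree E2" "pos_ext {b} E2 E3"
    "\<And>v. v \<in> Z ` set vs \<Longrightarrow> \<exists>p. path E3 v (rb K2) p"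
    using pos_extend[OF E2(1,2) rb(2) _ rb(3) finite_imageI[OF finite_set] Z_verts] ab(2)
    by (metis empty_subsetI insert_subset)
  have sub3: "E2 \<subseteq> E3" using pos_ext_subset[OF E3(4)] .
  have ext13: "pos_ext B E1 E3" using pos_ext_trans[OF E2(4) E3(4)] ab(2) by auto
  have "\<forall>v \<in> set vs. \<exists>p. path E3 (Z v) (rb K2) p" using E3(5) by blast
  then obtain P where P: "\<And>v. v \<in> set vs \<Longrightarrow> path E3 (Z v) (rb K2) (P v)" by metis
  have P_eq: "P v = Z v @ rb K2" if "v \<in> set vs" for v
    using pos_ext_outside[OF ext13 Z_new[OF that] P[OF that] rb(3)] by blast
  have P_path: "path E3 v (w1 @ rb K2) (P v)" if "v \<in> set vs" for v
    using path_mono[OF Z[OF that] sub3] P[OF that] by (auto simp: path_append)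
  have P_verts: "P v \<in> verts E3" if "v \<in> set vs" for v
    using path_verts[OF E3(1) P_path[OF that]] that vs1 verts_mono[OF sub2] verts_mono[OF sub3] by blast
  have P_stub: "(P v, (True, a), t) \<notin> E3" if "v \<in> set vs" for v t
  proof
    assume t: "(P v, (True, a), t) \<in> E3"
    have "P v \<notin> verts E2" using M[of "P v"] P_eq[OF that] rb(4) by (auto simp: K2_def)
    then have "(P v, (True, a), t) \<notin> E2" using verts_source by metis
    from pos_ext_edge[OF E3(4) t this] ab show False by simp
  qed
  have P'_stub3: "(P' v, (False, a), t) \<notin> E3" if "v \<in> set us" for v t
  proof
    assume "(P' v, (False, a), t) \<in> E3"
    then have t: "(t, (True, a), P' v) \<in> E3" using pgraph_sym[OF E3(1)] by fastforce
    have "(t, (True, a), P' v) \<notin> E1" using P'_stub[OF that] pgraph_sym[OF E1(1)] by fastforce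
    from pos_ext_edge[OF ext13 t this] P'_verts[OF that] show False by simp
  qed
  have good3: "good E3" "loss q E3 = loss q E" using E E1 E2 E3 by (simp_all add: good_def loss_def)

  define ps where "ps = map P vs"
  define qs where "qs = map P' us"
  have inj: "distinct ps"
    unfolding ps_def distinct_map
    using assms(2) path_inj[OF pgraph_inv_graph[OF E3(1)] P_path] P_path by (metis inj_onI)
  have inj': "distinct qs"
    unfolding qs_def distinct_map
    using assms(3) path_inj[OF pgraph_inv_graph[OF E1(1)] P'] P' by (metis inj_onI)
  define \<tau> where "\<tau> = map_of (zip ps qs)"
  have len: "length ps = ?k" "length qs = ?k" using assms(4) by (simp_all add: ps_def qs_def)
  have dom: "dom \<tau> = set ps" using len by (simp add: \<tau>_def dom_map_of_zip)
  have nth: "\<tau> (ps ! i) = Some (qs ! i)" if "i < ?k" for i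
    unfolding \<tau>_def using that len inj by (simp add: map_of_zip_nth)
  have someD: "\<exists>i < ?k. p = ps ! i \<and> p' = qs ! i" if "\<tau> p = Some p'" for p p'
    using map_of_SomeD[OF that[unfolded \<tau>_def]] len by (auto simp: set_zip)
  obtain E' where E': "good E'" "E3 \<subseteq> E'" "\<And>p p'. \<tau> p = Some p' \<Longrightarrow> (p, (True, a), p') \<in> E'"
  proof (rule good_connect[OF good3(1)])
    show "(p, (True, a)) \<in> stubs B E3" if "p \<in> dom \<tau>" for p
      using that P_stub P_verts ab by (auto simp: dom ps_def stubs_def)
    show "(p', linv (True, a)) \<in> stubs B E3" if pp: "\<tau> p = Some p'" for p p'
    proof -
      have "p' \<in> set qs" using someD[OF pp] len by auto
      then obtain v where "v \<in> set us" "p' = P' v" by (auto simp: qs_def)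
      then show ?thesis
        using P'_stub3 subsetD[OF verts_mono[OF sub3] subsetD[OF verts_mono[OF sub2] P'_verts]] ab
        by (auto simp: stubs_def)
    qed
    show "inj_on \<tau> (dom \<tau>)"
    proof (rule inj_onI)
      fix p p' assume "p \<in> dom \<tau>" "p' \<in> dom \<tau>" "\<tau> p = \<tau> p'"
      then obtain r where r: "\<tau> p = Some r" "\<tau> p' = Some r" by auto
      show "p = p'" using someD[OF r(1)] someD[OF r(2)] inj' len by (metis nth_eq_iff_index_eq)
    qed
    show "finite (dom \<tau>)" "card (dom \<tau>) \<le> ?k" using len card_length[of ps] by (auto simp: dom)
    show "2 * real ?k / q ^ K < bound - loss q E3" using K good3 by simp
    show "K \<le> length p \<and> K \<le> length p'" if pp: "\<tau> p = Some p'" for p p'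
    proof -
      obtain i where i: "i < ?k" "p = P (vs ! i)" "p' = P' (us ! i)"
        using someD[OF pp] assms(4) by (auto simp: ps_def qs_def)
      then show ?thesis
        using P_eq[of "vs ! i"] P'_new[of "us ! i"] rb(4) assms(4) by (auto simp: K2_def)
    qed
  qed blast
  have sub1': "E1 \<subseteq> E'" using sub2 sub3 E'(2) by blast
  have "path E' (vs ! i) ((w1 @ rb K2) @ (True, a) # winv w') (us ! i)" if "i < ?k" for i
  proof -
    have "(P (vs ! i), (True, a), P' (us ! i)) \<in> E'"
      using E'(3)[OF nth[OF that]] that assms(4) by (simp add: ps_def qs_def)
    moreover have "path E' (vs ! i) (w1 @ rb K2) (P (vs ! i))"
      using path_mono[OF P_path E'(2)] that by simp
    moreover have "path E' (P' (us ! i)) (winv w') (us ! i)"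
      using path_mono[OF path_winv[OF pgraph_inv_graph[OF E1(1)] P'] sub1'] that assms(4) by simp
    ultimately show ?thesis by (auto simp: path_append)
  qed
  moreover have "(w1 @ rb K2) @ (True, a) # winv w' \<in> words B" using w1 rb w' ab by simp
  moreover have "E \<subseteq> E'" using sub1 sub2 sub3 E'(2) by blast
  ultimately show ?thesis using E'(1) by blast
qed

section \<open>The infinite graph as a limit\<close>

text \<open>A requirement may speak of vertices that appear only late, so each one has to come up
  again and again. Decoding the stage as a pair makes it recur for every value of the second
  component, hence beyond every \<open>j\<close>.\<close>

lemma good_chain:
  assumes "good E0" "countable T" "T \<noteq> {}"
    "\<And>t E. t \<in> T \<Longrightarrow> good E \<Longrightarrow> \<exists>E'. good E' \<and> E \<subseteq> E' \<and> S t E E'"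
  shows "\<exists>f. f 0 = E0 \<and> (\<forall>i. good (f i)) \<and> incseq f \<and>
    (\<forall>t \<in> T. \<forall>j. \<exists>i \<ge> j. S t (f i) (f (Suc i)))"
proof -
  define e where "e = (\<lambda>n. from_nat_into T (fst (prod_decode n)))"
  have eT: "e n \<in> T" for n unfolding e_def by (rule from_nat_into[OF assms(3)])
  define step where "step = (\<lambda>n E E'. good E' \<and> E \<subseteq> E' \<and> S (e n) E E')"
  obtain f where f: "f 0 = E0" "\<And>n. good (f n)" "\<And>n. step n (f n) (f (Suc n))"
  proof -
    have "\<exists>f. \<forall>n. (good (f n) \<and> (n = 0 \<longrightarrow> f n = E0)) \<and> step n (f n) (f (Suc n))"
    proof (rule dependent_nat_choice)
      show "\<exists>x. good x \<and> (0 = 0 \<longrightarrow> x = E0)" using assms(1) by blast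
      fix E and n :: nat assume "good E \<and> (n = 0 \<longrightarrow> E = E0)"
      then have "\<exists>E'. step n E E'" unfolding step_def using assms(4)[OF eT] by blast
      then show "\<exists>E'. (good E' \<and> (Suc n = 0 \<longrightarrow> E' = E0)) \<and> step n E E'"
        by (auto simp: step_def)
    qed
    then show ?thesis using that by blast
  qed
  show ?thesis
  proof (intro exI[of _ f] conjI ballI allI)
    show "f 0 = E0" "good (f i)" for i by (rule f)+
    show "incseq f" using f(3) by (intro incseq_SucI) (auto simp: step_def)
    fix t j assume "t \<in> T"
    define i where "i = prod_encode (to_nat_on T t, j)"
    have "e i = t" using \<open>t \<in> T\<close> assms(2) by (simp add: e_def i_def)
    moreover have "j \<le> i" unfolding i_def by (rule le_prod_encode_2)
    ultimately show "\<exists>i \<ge> j. S t (f i) (f (Suc i))" using f(3)[of i] by (auto simp: step_def)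
  qed
qed

lemma finite_subset_incseq:
  assumes "finite D" "D \<subseteq> (\<Union>i. f i)" "incseq f"
  shows "\<exists>i :: nat. D \<subseteq> f i"
  using assms(1,2)
proof (induction D rule: finite_induct)
  case (insert x D)
  then obtain i j where "D \<subseteq> f i" "x \<in> f j" by auto
  then have "insert x D \<subseteq> f (max i j)"
    using incseqD[OF assms(3), of i "max i j"] incseqD[OF assms(3), of j "max i j"] by auto
  then show ?case by blast
qed simp

text \<open>The union may have infinitely many non-tree edges, so its budget is stated for finite
  sets of them, each of which lies in one finite stage.\<close>

lemma completion:
  assumes "good E0"
  shows "\<exists>G. pgraph B G \<and> E0 \<subseteq> G \<and>
    (\<forall>v \<in> verts G. \<forall>c \<in> words B. cyc_red c \<longrightarrow> (\<exists>n > 0. path G v (wpow c n) v)) \<and>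
    (\<forall>vs us. distinct vs \<longrightarrow> distinct us \<longrightarrow> length us = length vs \<longrightarrow> set vs \<subseteq> verts G \<longrightarrow>
       set us \<subseteq> verts G \<longrightarrow> (\<exists>b \<in> words B. \<forall>i < length vs. path G (vs ! i) b (us ! i))) \<and>
    (\<forall>D. finite D \<longrightarrow> D \<subseteq> nontree G \<longrightarrow> (\<Sum>(v, l, u) \<in> D. 1 / q ^ length v) \<le> bound)"
proof -
  \<comment> \<open>A requirement about vertices that are not yet present counts as met for the time
    being.\<close>
  define S where "S = (\<lambda>t (E :: ((bool \<times> 'a) list \<times> (bool \<times> 'a) \<times> (bool \<times> 'a) list) set) E'. case t of
      Inl (v, c) \<Rightarrow> v \<in> verts E \<and> cyc_red c \<longrightarrow> (\<exists>n > 0. path E' v (wpow c n) v)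
    | Inr (vs, us) \<Rightarrow> distinct vs \<and> distinct us \<and> length us = length vs \<and> set vs \<subseteq> verts E \<and>
        set us \<subseteq> verts E \<longrightarrow> (\<exists>b \<in> words B. \<forall>i < length vs. path E' (vs ! i) b (us ! i)))"
  define T :: "((bool \<times> 'a) list \<times> (bool \<times> 'a) list +
      (bool \<times> 'a) list list \<times> (bool \<times> 'a) list list) set"
    where "T = Inl ` (words B \<times> words B) \<union> Inr ` (lists (words B) \<times> lists (words B))"
  have "words B = lists (UNIV \<times> B)" by (auto simp: words_def in_lists_conv_set mem_Times_iff)
  then have cw: "countable (words B)"
    using finB by (simp add: countable_finite)
  then have T: "countable T" "T \<noteq> {}"
    unfolding T_def by (auto intro!: countable_Un countable_image countable_SIGMA)
  have step: "\<exists>E'. good E' \<and> E \<subseteq> E' \<and> S t E E'" if "t \<in> T" "good E" for t E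
  proof (cases t)
    case (Inl x)
    obtain v c where x: "x = (v, c)" by (cases x)
    have "c \<in> words B" using that(1) Inl x by (auto simp: T_def)
    then show ?thesis using burnside_step[OF that(2), of v c] that(2) Inl x
      by (cases "v \<in> verts E \<and> cyc_red c") (auto simp: S_def)
  next
    case (Inr x)
    obtain vs us where x: "x = (vs, us)" by (cases x)
    show ?thesis
    proof (cases "distinct vs \<and> distinct us \<and> length us = length vs \<and> set vs \<subseteq> verts E \<and> set us \<subseteq> verts E")
      case True
      then show ?thesis using transitive_step[OF that(2), of vs us] Inr x by (auto simp: S_def)
    next
      case False
      then show ?thesis using that(2) Inr x by (auto simp: S_def)
    qed
  qed
  obtain f where f: "f 0 = E0" "\<And>i. good (f i)" "incseq f"
    "\<And>t j. t \<in> T \<Longrightarrow> \<exists>i \<ge> j. S t (f i) (f (Suc i))"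
    using good_chain[OF assms T, of S, OF step] by auto
  define G where "G = (\<Union>i. f i)"
  have pg: "pgraph B (f i)" for i using f(2) by (simp add: good_def)
  have sub: "f i \<subseteq> G" for i by (auto simp: G_def)
  have vG: "verts G = (\<Union>i. verts (f i))" unfolding G_def verts_def by auto
  have incv: "incseq (\<lambda>i. verts (f i))"
    using f(3) verts_mono unfolding incseq_def by blast
  have pgG: "pgraph B G"
    unfolding pgraph_def inv_graph_def
  proof (intro conjI allI impI)
    fix s l t assume "(s, l, t) \<in> G"
    then show "(t, linv l, s) \<in> G" unfolding G_def by (auto dest: pgraph_sym[OF pg])
  next
    fix s l t t' assume "(s, l, t) \<in> G" "(s, l, t') \<in> G"
    then have "{(s, l, t), (s, l, t')} \<subseteq> (\<Union>i. f i)" unfolding G_def by blast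
    from finite_subset_incseq[OF _ this f(3)] obtain i where "{(s, l, t), (s, l, t')} \<subseteq> f i"
      by auto
    then have "(s, l, t) \<in> f i" "(s, l, t') \<in> f i" by simp_all
    then show "t = t'" by (rule pgraph_det[OF pg])
  next
    fix s l t assume "(s, l, t) \<in> G"
    then show "snd l \<in> B" unfolding G_def by (auto dest: pgraph_letter[OF pg])
  next
    fix s l t assume "(s, l, t) \<in> G" "s \<noteq> []"
    then show "(butlast s, last s, s) \<in> G"
      unfolding G_def by (auto dest: verts_source intro: pgraph_tree[OF pg])
  qed
  show ?thesis
  proof (intro exI[of _ G] conjI ballI allI impI)
    show "pgraph B G" by (rule pgG)
    show "E0 \<subseteq> G" using sub[of 0] f(1) by simp
  next
    fix v c assume *: "v \<in> verts G" "c \<in> words B" "cyc_red c"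
    then obtain j where j: "v \<in> verts (f j)" using vG by auto
    have "Inl (v, c) \<in> T" unfolding T_def using * verts_words[OF pgG] by blast
    then obtain i where i: "i \<ge> j" "S (Inl (v, c)) (f i) (f (Suc i))" using f(4) by blast
    then have "v \<in> verts (f i)" using j incseqD[OF incv] by blast
    then show "\<exists>n > 0. path G v (wpow c n) v"
      using i(2) *(3) path_mono[OF _ sub] by (fastforce simp: S_def)
  next
    fix vs us
    assume *: "distinct vs" "distinct us" "length us = length vs" "set vs \<subseteq> verts G" "set us \<subseteq> verts G"
    then obtain j where j: "set vs \<union> set us \<subseteq> verts (f j)"
      using finite_subset_incseq[OF _ _ incv, of "set vs \<union> set us"] vG by auto
    have "Inr (vs, us) \<in> T" unfolding T_def using * verts_words[OF pgG] by blast
    then obtain i where i: "i \<ge> j" "S (Inr (vs, us)) (f i) (f (Suc i))" using f(4) by blast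
    then have "set vs \<union> set us \<subseteq> verts (f i)" using j incseqD[OF incv] by blast
    then obtain b where b: "b \<in> words B" "\<forall>i' < length vs. path (f (Suc i)) (vs ! i') b (us ! i')"
      using i(2) * by (auto simp: S_def)
    then show "\<exists>b \<in> words B. \<forall>i < length vs. path G (vs ! i) b (us ! i)"
      using path_mono[OF _ sub] by blast
  next
    fix D assume D: "finite D" "D \<subseteq> nontree G"
    then have "D \<subseteq> (\<Union>i. f i)" by (auto simp: nontree_def G_def)
    then obtain i where "D \<subseteq> f i" using finite_subset_incseq[OF D(1) _ f(3)] by blast
    \<comment> \<open>Being a non-tree edge is decided by the label and the names of the ends, not
      by the surrounding graph.\<close>
    then have "D \<subseteq> nontree (f i)" using D(2) by (auto simp: nontree_def)
    moreover have "finite (nontree (f i))"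
      using f(2)[of i] by (auto simp: good_def nontree_def intro: finite_subset[of _ "f i"])
    moreover have "0 \<le> (case e of (v, l, u) \<Rightarrow> 1 / q ^ length v)" for e :: "(bool \<times> 'a) list \<times> (bool \<times> 'a) \<times> (bool \<times> 'a) list"
      using q_gt by (auto split: prod.splits)
    ultimately have "(\<Sum>(v, l, u) \<in> D. 1 / q ^ length v) \<le> loss q (f i)"
      unfolding loss_def by (intro sum_mono2) auto
    also have "\<dots> \<le> bound" using f(2)[of i] by (simp add: good_def)
    finally show "(\<Sum>(v, l, u) \<in> D. 1 / q ^ length v) \<le> bound" .
  qed
qed

end

section \<open>Stabilisers\<close>

lemma (in group) rcos_eq_iff:
  assumes "subgroup K G" "x \<in> carrier G" "y \<in> carrier G"
  shows "K #> x = K #> y \<longleftrightarrow> x \<otimes> inv y \<in> K"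
proof
  assume "K #> x = K #> y"
  then have "x \<in> K #> y" using rcos_self[OF assms(2,1)] by simp
  then obtain k where "k \<in> K" "x = k \<otimes> y" by (auto simp: r_coset_def)
  then show "x \<otimes> inv y \<in> K"
    using assms subgroup.mem_carrier[OF assms(1)] by (simp add: m_assoc)
next
  assume k: "x \<otimes> inv y \<in> K"
  have "x = (x \<otimes> inv y) \<otimes> y" using assms by (simp add: m_assoc)
  then have "x \<in> K #> y" using k unfolding r_coset_def by blast
  then show "K #> x = K #> y" using repr_independence[OF _ assms(3,1)] by simp
qed

context free_group
begin

definition stab :: "((bool \<times> 'a) list \<times> (bool \<times> 'a) \<times> (bool \<times> 'a) list) set \<Rightarrow> 'a set" where
  "stab E = {word_val F w |w. path E [] w []}"

lemma verts_carrier: "pgraph B E \<Longrightarrow> v \<in> verts E \<Longrightarrow> v \<in> words (carrier F)"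
  using verts_words words_carrier by blast

lemma path_carrier: "pgraph B E \<Longrightarrow> path E v w u \<Longrightarrow> w \<in> words (carrier F)"
  using path_words words_carrier by blast

lemma stab_subgroup:
  assumes "pgraph B E"
  shows "subgroup (stab E) F"
proof
  show "stab E \<subseteq> carrier F" using path_carrier[OF assms] by (auto simp: stab_def)
  show "\<one> \<in> stab E" unfolding stab_def by (intro CollectI exI[of _ "[]"]) simp
  fix x assume "x \<in> stab E"
  then obtain u where u: "x = word_val F u" "path E [] u []" by (auto simp: stab_def)
  then show "inv x \<in> stab E" unfolding stab_def
    using path_winv[OF pgraph_inv_graph[OF assms] u(2)] path_carrier[OF assms u(2)]
    by (intro CollectI exI[of _ "winv u"]) (simp add: word_val_winv)
  fix y assume "y \<in> stab E"
  then obtain w where w: "y = word_val F w" "path E [] w []" by (auto simp: stab_def)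
  then show "x \<otimes> y \<in> stab E" unfolding stab_def
    using u path_carrier[OF assms u(2)] path_carrier[OF assms w(2)]
    by (intro CollectI exI[of _ "u @ w"]) (auto simp: word_val_append path_append)
qed

text \<open>The element of \<open>F\<close> spelled by going out to \<open>v\<close>, along \<open>w\<close> and back from \<open>u\<close> in the tree.\<close>

definition hol :: "(bool \<times> 'a) list \<Rightarrow> (bool \<times> 'a) list \<Rightarrow> (bool \<times> 'a) list \<Rightarrow> 'a" where
  "hol v w u = word_val F (v @ w @ winv u)"

lemma hol_closed:
  assumes "pgraph B E" "path E v w u" "v \<in> verts E"
  shows "hol v w u \<in> carrier F"
  unfolding hol_def using verts_carrier[OF assms(1)] path_carrier[OF assms(1,2)] path_verts[OF assms] assms(3)
  by simp

lemma hol_Nil: "pgraph B E \<Longrightarrow> v \<in> verts E \<Longrightarrow> hol v [] v = \<one>"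
  unfolding hol_def using verts_carrier by (simp add: word_val_append word_val_winv)

lemma hol_append:
  assumes "pgraph B E" "path E v w s" "path E s w' u" "v \<in> verts E"
  shows "hol v (w @ w') u = hol v w s \<otimes> hol s w' u"
proof -
  have *: "v \<in> words (carrier F)" "w \<in> words (carrier F)" "w' \<in> words (carrier F)"
    "s \<in> words (carrier F)" "u \<in> words (carrier F)"
    using verts_carrier[OF assms(1)] path_carrier[OF assms(1)] path_verts[OF assms(1)] assms(2-) by metis+
  then have "inv word_val F s \<otimes> (word_val F s \<otimes> (word_val F w' \<otimes> inv word_val F u))
      = word_val F w' \<otimes> inv word_val F u"
    by (simp flip: m_assoc)
  then show ?thesis using * unfolding hol_def by (simp add: word_val_append word_val_winv m_assoc)
qed

lemma hol_winv:
  assumes "pgraph B E" "path E v w u" "v \<in> verts E"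
  shows "hol u (winv w) v = inv hol v w u"
proof -
  have "v \<in> words (carrier F)" "w \<in> words (carrier F)" "u \<in> words (carrier F)"
    using verts_carrier[OF assms(1)] path_carrier[OF assms(1)] path_verts[OF assms(1)] assms(2-) by metis+
  then show ?thesis
    unfolding hol_def by (simp add: word_val_append word_val_winv inv_mult_group m_assoc)
qed

lemma hol_stab:
  assumes "pgraph B E" "path E v w u" "v \<in> verts E"
  shows "hol v w u \<in> stab E"
proof -
  have "u \<in> verts E" using path_verts[OF assms] .
  then have "path E [] (v @ w @ winv u) []"
    using path_to_vert[OF assms(1,3)] assms(2)
      path_winv[OF pgraph_inv_graph[OF assms(1)] path_to_vert[OF assms(1), of u]]
    unfolding path_append by blast
  then show ?thesis unfolding hol_def stab_def by blast
qed

lemma hol_edge_stab: "pgraph B E \<Longrightarrow> (v, l, u) \<in> E \<Longrightarrow> hol v [l] u \<in> stab E"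
  using hol_stab[of E v "[l]" u] verts_source[of v l u E] by simp

lemma hol_edge_linv: "pgraph B E \<Longrightarrow> (v, l, u) \<in> E \<Longrightarrow> hol u [linv l] v = inv hol v [l] u"
  using hol_winv[of E v "[l]" u] verts_source[of v l u E] by simp

end

section \<open>Stabilisers of subgraphs are free factors\<close>

text \<open>The van der Waerden action: left multiplication by an element of the factor tagged
  \<open>i\<close>, carried out on normal forms before their values are known to be
  distinct.\<close>

definition nf_mult :: "('a, 'b) monoid_scheme \<Rightarrow> bool \<Rightarrow> 'a \<Rightarrow> (bool \<times> 'a) list \<Rightarrow> (bool \<times> 'a) list" where
  "nf_mult G i g n =
     (case n of
        [] \<Rightarrow> if g = \<one>\<^bsub>G\<^esub> then [] else [(i, g)]
      | (j, x) # m \<Rightarrow>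
          if j = i then (if g \<otimes>\<^bsub>G\<^esub> x = \<one>\<^bsub>G\<^esub> then m else (i, g \<otimes>\<^bsub>G\<^esub> x) # m)
          else if g = \<one>\<^bsub>G\<^esub> then n else (i, g) # n)"

definition nf_val :: "('a, 'b) monoid_scheme \<Rightarrow> (bool \<times> 'a) list \<Rightarrow> 'a" where
  "nf_val G n = foldr (\<otimes>\<^bsub>G\<^esub>) (map snd n) \<one>\<^bsub>G\<^esub>"

lemma nf_val_simps [simp]:
  "nf_val G [] = \<one>\<^bsub>G\<^esub>" "nf_val G (x # n) = snd x \<otimes>\<^bsub>G\<^esub> nf_val G n"
  by (simp_all add: nf_val_def)

lemma nf_simps [simp]:
  "[] \<in> free_product_normal_forms G H L"
  "(i, x) # n \<in> free_product_normal_forms G H L \<longleftrightarrow>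
     x \<in> (if i then H else L) \<and> x \<noteq> \<one>\<^bsub>G\<^esub> \<and> n \<in> free_product_normal_forms G H L \<and>
     (n \<noteq> [] \<longrightarrow> fst (hd n) \<noteq> i)"
  by (cases n; auto simp: free_product_normal_forms_def distinct_adj_Cons)+

locale group_pair = group G for G (structure) +
  fixes H L :: "'a set"
  assumes H: "subgroup H G" and L: "subgroup L G"
begin

abbreviation NF where "NF \<equiv> free_product_normal_forms G H L"
abbreviation A :: "bool \<Rightarrow> 'a set" where "A i \<equiv> (if i then H else L)"

lemma A_subgroup: "subgroup (A i) G"
  using H L by simp

lemma A_carrier [simp]: "x \<in> A i \<Longrightarrow> x \<in> carrier G"
  using subgroup.mem_carrier[OF A_subgroup] .

lemma A_mult: "x \<in> A i \<Longrightarrow> y \<in> A i \<Longrightarrow> x \<otimes> y \<in> A i"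
  using subgroup.m_closed[OF A_subgroup] .

lemma nf_val_closed: "n \<in> NF \<Longrightarrow> nf_val G n \<in> carrier G"
proof (induction n)
  case (Cons a n)
  then show ?case by (cases a) (simp add: A_carrier del: A_carrier, metis A_carrier m_closed)
qed simp

lemma nf_mult_closed: "n \<in> NF \<Longrightarrow> g \<in> A i \<Longrightarrow> nf_mult G i g n \<in> NF"
  by (cases n) (auto simp: nf_mult_def A_mult[simplified] split: if_splits intro: A_mult[of _ True, simplified] A_mult[of _ False, simplified])

lemma nf_mult_one: "n \<in> NF \<Longrightarrow> nf_mult G i \<one> n = n"
proof (cases n)
  case (Cons a m)
  assume "n \<in> NF"
  moreover obtain j x where "a = (j, x)" by (cases a)
  ultimately show ?thesis using Cons A_carrier[of x j] by (auto simp: nf_mult_def)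
qed (simp add: nf_mult_def)

lemma nf_val_mult:
  assumes "n \<in> NF" "g \<in> A i"
  shows "nf_val G (nf_mult G i g n) = g \<otimes> nf_val G n"
proof (cases n)
  case Nil
  then show ?thesis using A_carrier[OF assms(2)] by (simp add: nf_mult_def)
next
  case (Cons a m)
  obtain j x where a: "a = (j, x)" by (cases a)
  have "g \<in> carrier G" "x \<in> carrier G" "nf_val G m \<in> carrier G"
    using assms Cons a A_carrier[of x j] A_carrier[of g i] nf_val_closed by auto
  then show ?thesis using Cons a by (auto simp: nf_mult_def simp flip: m_assoc)
qed

text \<open>The critical case is a first syllable consumed by \<open>h\<close>: the next one belongs
  to the other factor, so \<open>g\<close> meets it without merging, in agreement with
  \<open>g \<otimes> h \<otimes> x = g\<close>.\<close>

lemma nf_mult_mult: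
  assumes "n \<in> NF" "g \<in> A i" "h \<in> A i"
  shows "nf_mult G i g (nf_mult G i h n) = nf_mult G i (g \<otimes> h) n"
proof (cases n)
  case Nil
  then show ?thesis using A_carrier[OF assms(2)] A_carrier[OF assms(3)]
    by (auto simp: nf_mult_def)
next
  case (Cons a m)
  obtain j x where a: "a = (j, x)" by (cases a)
  have c: "g \<in> carrier G" "h \<in> carrier G" "x \<in> carrier G"
    using assms Cons a A_carrier[of x j] A_carrier[of g i] A_carrier[of h i] by auto
  have m: "m \<noteq> [] \<longrightarrow> fst (hd m) \<noteq> j" using assms(1) Cons a by simp
  show ?thesis
  proof (cases "j = i")
    case [simp]: True
    show ?thesis
    proof (cases "h \<otimes> x = \<one>")
      case True
      then have "g \<otimes> h \<otimes> x = g" using c by (simp add: m_assoc)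
      then show ?thesis using True Cons a m c
        by (cases m) (auto simp: nf_mult_def split: list.splits)
    next
      case False
      then show ?thesis using Cons a c by (simp add: nf_mult_def m_assoc)
    qed
  next
    case False
    then show ?thesis using Cons a c by (auto simp: nf_mult_def)
  qed
qed

end

section \<open>The action of \<open>F\<close> on vertices paired with normal forms\<close>

locale subgraph = free_group F B for F (structure) and B +
  fixes E G :: "((bool \<times> 'a) list \<times> (bool \<times> 'a) \<times> (bool \<times> 'a) list) set"
  assumes pgE: "pgraph B E" and pgG: "pgraph B G" and EG: "E \<subseteq> G"
begin

text \<open>The complementary factor. Tree edges outside \<open>E\<close> contribute only the
  identity, so the essential generators come from the non-tree edges outside
  \<open>E\<close>.\<close>

definition L :: "'a set" where
  "L = generate F {hol v [l] u |v l u. (v, l, u) \<in> G - E}"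

lemma L_subgroup: "subgroup L F"
  unfolding L_def using hol_edge_stab[OF pgG] subgroup.subset[OF stab_subgroup[OF pgG]]
  by (intro generate_is_subgroup) blast

sublocale group_pair F "stab E" L
  by (intro group_pair.intro group_pair_axioms.intro is_group L_subgroup stab_subgroup[OF pgE])

lemma hol_factor: "(v, l, u) \<in> G \<Longrightarrow> hol v [l] u \<in> A ((v, l, u) \<in> E)"
proof (cases "(v, l, u) \<in> E")
  case True
  then show ?thesis using hol_edge_stab[OF pgE True] by simp
next
  case False
  assume "(v, l, u) \<in> G"
  with False have "hol v [l] u \<in> L" unfolding L_def by (intro generate.incl) blast
  then show ?thesis using False by simp
qed

text \<open>
  An edge multiplies a normal form by the inverse of the element of \<open>stab E\<close> or \<open>L\<close> that it
  carries; tree edges carry the identity.  This makes \<open>F\<close> act on vertices paired with normal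
  forms, and the unique way for a loop to lead from a normal form to the empty one is to have
  its value.
\<close>

definition T :: "(((bool \<times> 'a) list \<times> (bool \<times> 'a) list) \<times> (bool \<times> 'a) \<times>
    ((bool \<times> 'a) list \<times> (bool \<times> 'a) list)) set" where
  "T = {((v, n), l, (u, nf_mult F ((v, l, u) \<in> E) (inv (hol v [l] u)) n)) |v n l u.
          (v, l, u) \<in> G \<and> n \<in> NF}"

lemma T_edge:
  "((v, n), l, (u, n')) \<in> T \<longleftrightarrow>
     (v, l, u) \<in> G \<and> n \<in> NF \<and> n' = nf_mult F ((v, l, u) \<in> E) (inv (hol v [l] u)) n"
  unfolding T_def mem_Collect_eq prod.inject by blast

text \<open>The opposite edge has the same tag and carries the inverse element, so by
  \<open>nf_mult_mult\<close> it undoes the multiplication.\<close>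

lemma T_inv_graph: "inv_graph T"
  unfolding inv_graph_def
proof (intro conjI allI impI)
  fix s l t assume "(s, l, t) \<in> T"
  then obtain v n u where e: "s = (v, n)" "(v, l, u) \<in> G" "n \<in> NF"
    "t = (u, nf_mult F ((v, l, u) \<in> E) (inv (hol v [l] u)) n)"
    unfolding T_def by blast
  let ?i = "(v, l, u) \<in> E" and ?g = "hol v [l] u"
  have g: "?g \<in> A ?i" using hol_factor[OF e(2)] .
  then have g': "inv ?g \<in> A ?i" using subgroup.m_inv_closed[OF A_subgroup] by blast
  have tag: "(u, linv l, v) \<in> E \<longleftrightarrow> ?i"
    using pgraph_sym[OF pgE, of v l u] pgraph_sym[OF pgE, of u "linv l" v] by auto
  have "hol u [linv l] v = inv ?g"
    using hol_edge_linv[OF pgG e(2)] .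
  then have "inv (hol u [linv l] v) = ?g" using A_carrier[OF g] by simp
  moreover have "nf_mult F ?i ?g (nf_mult F ?i (inv ?g) n) = n"
    unfolding nf_mult_mult[OF e(3) g g'] using A_carrier[OF g] nf_mult_one[OF e(3)] by simp
  ultimately show "(t, linv l, s) \<in> T"
    unfolding e(1,4) T_edge tag using pgraph_sym[OF pgG e(2)] nf_mult_closed[OF e(3) g'] by simp
next
  fix s l t t' assume "(s, l, t) \<in> T" "(s, l, t') \<in> T"
  then show "t = t'" unfolding T_def using pgraph_det[OF pgG] by blast
qed

lemma path_T_fst: "path T s w t \<Longrightarrow> path G (fst s) w (fst t)"
  by (induction w arbitrary: s) (auto simp: T_def)

lemma path_T_tree: "v \<in> verts G \<Longrightarrow> n \<in> NF \<Longrightarrow> path T ([], n) v (v, n)"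
proof (induction v rule: rev_induct)
  case (snoc l v)
  have e: "(v, l, v @ [l]) \<in> G" using verts_snoc[OF pgG snoc.prems(1)] .
  then have v: "v \<in> verts G" by (rule verts_source)
  have "hol v [l] (v @ [l]) = hol (v @ [l]) [] (v @ [l])" by (simp add: hol_def)
  also have "\<dots> = \<one>" using hol_Nil[OF pgG snoc.prems(1)] .
  finally have "((v, n), l, (v @ [l], n)) \<in> T"
    using e snoc.prems(2) nf_mult_one by (simp add: T_edge)
  then show ?case using snoc.IH[OF v snoc.prems(2)] by (auto simp: path_append)
qed simp

lemma path_T_E:
  "path E v w u \<Longrightarrow> v \<in> verts E \<Longrightarrow> n \<in> NF \<Longrightarrow>
   path T (v, n) w (u, nf_mult F True (inv (hol v w u)) n)"
proof (induction w arbitrary: v n)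
  case Nil
  then show ?case using hol_Nil[OF pgE] nf_mult_one by simp
next
  case (Cons l w)
  then obtain s where s: "(v, l, s) \<in> E" "path E s w u" by auto
  have sE: "s \<in> verts E" using verts_target[OF pgE s(1)] .
  let ?g = "hol v [l] s" and ?h = "hol s w u"
  have g: "?g \<in> A True" "?h \<in> A True"
    using hol_stab[OF pgE, of v "[l]" s] hol_stab[OF pgE s(2) sE] s(1) Cons.prems(2) by auto
  then have g': "inv ?g \<in> A True" "inv ?h \<in> A True"
    using subgroup.m_inv_closed[OF A_subgroup] by blast+
  let ?n = "nf_mult F True (inv ?g) n"
  have n: "?n \<in> NF" using nf_mult_closed[OF Cons.prems(3) g'(1)] .
  have "((v, n), l, (s, ?n)) \<in> T" using s EG Cons.prems(3) by (auto simp: T_edge)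
  moreover have "path T (s, ?n) w (u, nf_mult F True (inv ?h) ?n)"
    by (rule Cons.IH[OF s(2) sE n])
  moreover have "nf_mult F True (inv ?h) ?n = nf_mult F True (inv (hol v (l # w) u)) n"
    using hol_append[OF pgE, of v "[l]" s w u] s Cons.prems(2) A_carrier[OF g(1)] A_carrier[OF g(2)]
    unfolding nf_mult_mult[OF Cons.prems(3) g'(2,1)] by (simp add: inv_mult_group)
  ultimately show ?case by auto
qed

lemma path_T_stab:
  assumes "h \<in> stab E"
  shows "\<exists>w \<in> words B. word_val F w = h \<and>
           (\<forall>n \<in> NF. path T ([], n) w ([], nf_mult F True (inv h) n))"
proof -
  obtain w where w: "h = word_val F w" "path E [] w []" using assms by (auto simp: stab_def)
  have "hol [] w [] = h" using w by (simp add: hol_def)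
  then show ?thesis using path_T_E[OF w(2)] w path_words[OF pgE w(2)] by auto
qed

text \<open>For a generator, the word goes out along the tree, over the edge and back along the
  tree; only the edge changes the normal form. Products follow by concatenation.\<close>

lemma path_T_L:
  assumes "g \<in> L"
  shows "\<exists>w \<in> words B. word_val F w = g \<and>
           (\<forall>n \<in> NF. path T ([], n) w ([], nf_mult F False (inv g) n))"
proof -
  have LA: "x \<in> L \<Longrightarrow> x \<in> A False \<and> inv x \<in> A False \<and> x \<in> carrier F" for x
    using subgroup.m_inv_closed[OF L_subgroup] subgroup.mem_carrier[OF L_subgroup] by simp
  have edge: "\<exists>w \<in> words B. word_val F w = hol v [l] u \<and>
      (\<forall>n \<in> NF. path T ([], n) w ([], nf_mult F False (inv (hol v [l] u)) n))"
    if e: "(v, l, u) \<in> G" "(v, l, u) \<notin> E" for v l u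
  proof (intro bexI conjI ballI)
    have vu: "v \<in> verts G" "u \<in> verts G" using verts_source verts_target[OF pgG] e(1) by metis+
    show "word_val F (v @ [l] @ winv u) = hol v [l] u" by (simp add: hol_def)
    show "v @ [l] @ winv u \<in> words B"
      using verts_words[OF pgG] vu pgraph_letter[OF pgG e(1)] by simp
    fix n assume n: "n \<in> NF"
    let ?n = "nf_mult F False (inv (hol v [l] u)) n"
    have "hol v [l] u \<in> L" using hol_factor[OF e(1)] e(2) by simp
    then have n': "?n \<in> NF" using nf_mult_closed[OF n, of _ False] LA by blast
    have "((v, n), l, (u, ?n)) \<in> T" using e n by (simp add: T_edge)
    then show "path T ([], n) (v @ [l] @ winv u) ([], ?n)"
      using path_T_tree[OF vu(1) n] path_winv[OF T_inv_graph path_T_tree[OF vu(2) n']]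
      unfolding path_append by auto
  qed
  show ?thesis
    using assms[unfolded L_def]
  proof (induction rule: generate.induct)
    case one
    show ?case by (intro bexI[of _ "[]"]) (auto simp: nf_mult_one)
  next
    case (incl h)
    then show ?case using edge by blast
  next
    case (inv h)
    then obtain v l u where h: "h = hol v [l] u" "(v, l, u) \<in> G" "(v, l, u) \<notin> E" by blast
    then have "inv h = hol u [linv l] v"
      using hol_edge_linv[OF pgG] by simp
    moreover have "(u, linv l, v) \<notin> E"
      using h(3) pgraph_sym[OF pgE, of u "linv l" v] by auto
    ultimately show ?case using edge[OF pgraph_sym[OF pgG h(2)]] by simp
  next
    case (eng g h)
    then obtain w w' where w: "w \<in> words B" "word_val F w = g"
      "\<And>n. n \<in> NF \<Longrightarrow> path T ([], n) w ([], nf_mult F False (inv g) n)"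
      "w' \<in> words B" "word_val F w' = h"
      "\<And>n. n \<in> NF \<Longrightarrow> path T ([], n) w' ([], nf_mult F False (inv h) n)" by blast
    have gh: "g \<in> L" "h \<in> L" using eng unfolding L_def by blast+
    show ?case
    proof (intro bexI[of _ "w @ w'"] conjI ballI)
      show "word_val F (w @ w') = g \<otimes> h" using w by (simp add: word_val_append words_carrier)
      show "w @ w' \<in> words B" using w by simp
      fix n assume n: "n \<in> NF"
      have n': "nf_mult F False (inv g) n \<in> NF" using nf_mult_closed[OF n, of _ False] LA[OF gh(1)] by blast
      have "nf_mult F False (inv h) (nf_mult F False (inv g) n) = nf_mult F False (inv (g \<otimes> h)) n"
        using nf_mult_mult[OF n, of "inv h" False "inv g"] LA[OF gh(1)] LA[OF gh(2)]
        by (simp add: inv_mult_group)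
      then show "path T ([], n) (w @ w') ([], nf_mult F False (inv (g \<otimes> h)) n)"
        using w(3)[OF n] w(6)[OF n'] by (auto simp: path_append)
    qed
  qed
qed

lemma path_T_factor:
  assumes "x \<in> A i"
  shows "\<exists>w \<in> words B. word_val F w = x \<and>
           (\<forall>n \<in> NF. path T ([], n) w ([], nf_mult F i (inv x) n))"
  using path_T_stab path_T_L assms by (cases i) auto

text \<open>Each syllable is spelled by a word that strips it off. This yields uniqueness of normal
  forms, since the value then determines where the form came from.\<close>

lemma path_T_nf:
  "n \<in> NF \<Longrightarrow> \<exists>w \<in> words B. word_val F w = nf_val F n \<and> path T ([], n) w ([], [])"
proof (induction n)
  case Nil
  show ?case by (rule bexI[of _ "[]"]) auto
next
  case (Cons a n)
  obtain i x where a: "a = (i, x)" by (cases a)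
  have x: "x \<in> A i" "n \<in> NF" using Cons.prems a by auto
  obtain w where w: "w \<in> words B" "word_val F w = x"
    "path T ([], a # n) w ([], nf_mult F i (inv x) (a # n))"
    using path_T_factor[OF x(1)] Cons.prems by blast
  obtain w' where w': "w' \<in> words B" "word_val F w' = nf_val F n" "path T ([], n) w' ([], [])"
    using Cons.IH[OF x(2)] by blast
  have "nf_mult F i (inv x) (a # n) = n" using A_carrier[OF x(1)] by (simp add: nf_mult_def a)
  then show ?case using w w' a
    by (intro bexI[of _ "w @ w'"]) (auto simp: path_append word_val_append words_carrier)
qed

text \<open>This yields existence of normal forms: a loop of \<open>G\<close>, followed from the
  empty form, builds up a form for the inverse of the element it spells.\<close>

lemma path_T_lift:
  "path G v w u \<Longrightarrow> v \<in> verts G \<Longrightarrow> n \<in> NF \<Longrightarrow>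
   \<exists>n' \<in> NF. path T (v, n) w (u, n') \<and> nf_val F n' = inv (hol v w u) \<otimes> nf_val F n"
proof (induction w arbitrary: v n)
  case Nil
  then show ?case using hol_Nil[OF pgG] nf_val_closed by auto
next
  case (Cons l w)
  then obtain s where s: "(v, l, s) \<in> G" "path G s w u" by auto
  have sG: "s \<in> verts G" using verts_target[OF pgG s(1)] .
  let ?i = "(v, l, s) \<in> E" and ?g = "hol v [l] s"
  have g: "?g \<in> A ?i" using hol_factor[OF s(1)] .
  then have g': "inv ?g \<in> A ?i" using subgroup.m_inv_closed[OF A_subgroup] by blast
  let ?n = "nf_mult F ?i (inv ?g) n"
  have n: "?n \<in> NF" using nf_mult_closed[OF Cons.prems(3) g'] .
  obtain n' where n': "n' \<in> NF" "path T (s, ?n) w (u, n')"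
    "nf_val F n' = inv (hol s w u) \<otimes> nf_val F ?n"
    using Cons.IH[OF s(2) sG n] by blast
  have "hol v (l # w) u = ?g \<otimes> hol s w u"
    using hol_append[OF pgG, of v "[l]" s w u] s Cons.prems(2) by simp
  then have "nf_val F n' = inv (hol v (l # w) u) \<otimes> nf_val F n"
    using n'(3) nf_val_mult[OF Cons.prems(3) g'] A_carrier[OF g] hol_closed[OF pgG s(2) sG]
      nf_val_closed[OF Cons.prems(3)] by (simp add: inv_mult_group m_assoc)
  moreover have "path T (v, n) (l # w) (u, n')" using n'(2) s(1) Cons.prems(3) by (auto simp: T_edge)
  ultimately show ?case using n'(1) by blast
qed

theorem free_factor_stab: "free_factor F (stab E) (stab G)"
proof -
  have "bij_betw (nf_val F) NF (stab G)"
    unfolding bij_betw_def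
  proof (intro conjI equalityI subsetI)
    show "inj_on (nf_val F) NF"
    proof (rule inj_onI)
      fix n m assume nm: "n \<in> NF" "m \<in> NF" "nf_val F n = nf_val F m"
      obtain w where w: "w \<in> words B" "word_val F w = nf_val F n" "path T ([], n) w ([], [])"
        using path_T_nf nm by blast
      obtain w' where w': "w' \<in> words B" "word_val F w' = nf_val F m" "path T ([], m) w' ([], [])"
        using path_T_nf nm by blast
      \<comment> \<open>Read backwards from the empty form, both words have the same value, so they
        end at the same pair.\<close>
      have "([], n) = ([] :: (bool \<times> 'a) list, m)"
        using path_cong_word_val[OF T_inv_graph _ _ _ path_winv[OF T_inv_graph w(3)]
            path_winv[OF T_inv_graph w'(3)]] w w' nm(3) by (simp add: word_val_winv words_carrier)
      then show "n = m" by simp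
    qed
  next
    fix x assume "x \<in> nf_val F ` NF"
    then obtain n w where "x = word_val F w" "path T ([], n) w ([], [])" using path_T_nf by force
    then show "x \<in> stab G" using path_T_fst unfolding stab_def by fastforce
  next
    fix x assume "x \<in> stab G"
    then obtain w where w: "x = word_val F w" "path G [] w []" by (auto simp: stab_def)
    have wc: "w \<in> words (carrier F)" using path_carrier[OF pgG w(2)] .
    obtain n where n: "n \<in> NF" "nf_val F n = inv (hol [] (winv w) []) \<otimes> \<one>"
      using path_T_lift[OF path_winv[OF pgraph_inv_graph[OF pgG] w(2)], of "[]"] by auto
    then have "nf_val F n = x" using wc w by (simp add: hol_def word_val_winv)
    then show "x \<in> nf_val F ` NF" using n by blast
  qed
  then have "is_free_product F (stab G) (stab E) L"
    unfolding is_free_product_def nf_val_def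
    using stab_subgroup[OF pgG] stab_subgroup[OF pgE] L_subgroup by simp
  then show ?thesis unfolding free_factor_def by blast
qed

end

section \<open>A finite graph for a finitely generated subgroup\<close>

context free_group
begin

lemma word_cosets_cong:
  assumes "subgroup H F" "u \<in> words B" "v \<in> words B" "w \<in> words B"
    "H #> word_val F u = H #> word_val F v"
  shows "H #> word_val F (u @ w) = H #> word_val F (v @ w)"
proof -
  have "H #> word_val F (x @ w) = (H #> word_val F x) #> word_val F w" if "x \<in> words B" for x
    using coset_mult_assoc[OF subgroup.subset[OF assms(1)]] that assms(4)
    by (simp add: word_val_append words_carrier)
  then show ?thesis using assms by simp
qed

text \<open>A finite piece of the Schreier graph of \<open>H\<close>, with each coset named by a
  tree path. Injectivity takes the place of Stallings foldings: two names of one coset never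
  arise.\<close>

definition coset_graph ::
    "'a set \<Rightarrow> ((bool \<times> 'a) list \<times> (bool \<times> 'a) \<times> (bool \<times> 'a) list) set \<Rightarrow> bool" where
  "coset_graph H E \<longleftrightarrow> pgraph B E \<and> finite E \<and>
     (\<forall>v l u. (v, l, u) \<in> E \<longrightarrow> H #> word_val F (v @ [l]) = H #> word_val F u) \<and>
     inj_on (\<lambda>v. H #> word_val F v) (verts E)"

lemma coset_graph_path:
  assumes "subgroup H F" "coset_graph H E"
  shows "path E v w u \<Longrightarrow> v \<in> verts E \<Longrightarrow> H #> word_val F (v @ w) = H #> word_val F u"
proof (induction w arbitrary: v)
  case (Cons l w)
  then obtain s where s: "(v, l, s) \<in> E" "path E s w u" by auto
  have pg: "pgraph B E" using assms(2) by (simp add: coset_graph_def)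
  have "s \<in> verts E" using verts_target[OF pg s(1)] .
  have "H #> word_val F (v @ [l]) = H #> word_val F s"
    using assms(2) s(1) unfolding coset_graph_def by blast
  then have "H #> word_val F ((v @ [l]) @ w) = H #> word_val F (s @ w)"
    using verts_words[OF pg] path_words[OF pg s(2)] \<open>s \<in> verts E\<close> Cons.prems(2)
      pgraph_letter[OF pg s(1)] by (intro word_cosets_cong[OF assms(1)]) auto
  then show ?case using Cons.IH[OF s(2) \<open>s \<in> verts E\<close>] by simp
qed simp

lemma coset_graph_step:
  assumes "subgroup H F" "coset_graph H E" "v \<in> verts E" "snd l \<in> B"
  shows "\<exists>E' u. coset_graph H E' \<and> E \<subseteq> E' \<and> (v, l, u) \<in> E'"
proof (cases "\<exists>u. (v, l, u) \<in> E")
  case True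
  then show ?thesis using assms(2) by blast
next
  case False
  have E: "pgraph B E" "finite E" "inj_on (\<lambda>v. H #> word_val F v) (verts E)"
    "\<And>v l u. (v, l, u) \<in> E \<Longrightarrow> H #> word_val F (v @ [l]) = H #> word_val F u"
    using assms(2) unfolding coset_graph_def by blast+
  have st: "(v, l) \<in> stubs B E" using False assms(3,4) by (auto simp: stubs_def)
  have vB: "v \<in> words B" using verts_words[OF E(1) assms(3)] .
  have cancel: "H #> word_val F (u @ [linv l]) = H #> word_val F v"
    if "u \<in> words B" "H #> word_val F u = H #> word_val F (v @ [l])" for u
  proof -
    have "H #> word_val F (u @ [linv l]) = H #> word_val F ((v @ [l]) @ [linv l])"
      using that vB assms(4) by (intro word_cosets_cong assms(1)) auto
    also have "word_val F ((v @ [l]) @ [linv l]) = word_val F v"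
      using words_carrier[OF vB] basis_carrier assms(4)
      by (auto simp: word_val_append letter_val_linv)
    finally show ?thesis .
  qed
  show ?thesis
  proof (cases "\<exists>u \<in> verts E. H #> word_val F u = H #> word_val F (v @ [l])")
    case True
    then obtain u where u: "u \<in> verts E" "H #> word_val F u = H #> word_val F (v @ [l])" by blast
    have uv: "H #> word_val F (u @ [linv l]) = H #> word_val F v"
      using cancel[OF verts_words[OF E(1) u(1)] u(2)] .
    \<comment> \<open>An edge there would lead to the coset of \<open>v\<close>, hence to
      \<open>v\<close> itself by injectivity, and its inverse would be the missing edge at
      \<open>v\<close>.\<close>
    have "(u, linv l, z) \<notin> E" for z
    proof
      assume z: "(u, linv l, z) \<in> E"
      then have "z = v"
        using E(4)[OF z] uv inj_onD[OF E(3)] verts_target[OF E(1) z] assms(3) by simp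
      then show False using pgraph_sym[OF E(1) z] False by simp
    qed
    then have st': "(u, linv l) \<in> stubs B E" using u(1) assms(4) by (auto simp: stubs_def)
    let ?\<tau> = "[v \<mapsto> u]"
    let ?E' = "E \<union> {(p, l, p') |p p'. ?\<tau> p = Some p'} \<union> {(p', linv l, p) |p p'. ?\<tau> p = Some p'}"
    have pg: "pgraph B ?E'" "verts ?E' = verts E"
      by (rule pgraph_connect[OF E(1), of ?\<tau> l]; use st st' in \<open>auto split: if_splits\<close>)+
    have eq: "?E' = E \<union> {(v, l, u), (u, linv l, v)}" by (auto split: if_splits)
    have "coset_graph H ?E'"
      unfolding coset_graph_def pg(2)
    proof (intro conjI allI impI pg(1) E(3))
      show "finite ?E'" unfolding eq using E(2) by simp
      fix s m t assume "(s, m, t) \<in> ?E'"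
      then show "H #> word_val F (s @ [m]) = H #> word_val F t"
        unfolding eq by (cases "(s, m, t) \<in> E") (rule E(4), assumption, use u(2) uv in auto)
    qed
    then show ?thesis unfolding eq by blast
  next
    case new: False
    let ?E' = "E \<union> arcs v l (v @ [l])"
    have vv: "H #> word_val F ((v @ [l]) @ [linv l]) = H #> word_val F v"
      by (rule cancel[OF _ refl]) (simp add: vB assms(4))
    have "coset_graph H ?E'"
      unfolding coset_graph_def verts_expand[OF st]
    proof (intro conjI allI impI)
      show "pgraph B ?E'" by (rule pgraph_expand[OF E(1) st])
      show "finite ?E'" using E(2) by (simp add: arcs_def)
      show "inj_on (\<lambda>v. H #> word_val F v) (insert (v @ [l]) (verts E))"
        using E(3) new by (auto simp: image_iff)
      fix s m t assume "(s, m, t) \<in> ?E'"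
      then consider "(s, m, t) \<in> E" | "s = v" "m = l" "t = v @ [l]" | "s = v @ [l]" "m = linv l" "t = v"
        by (auto simp: arcs_def)
      then show "H #> word_val F (s @ [m]) = H #> word_val F t"
      proof cases
        case 1
        then show ?thesis by (rule E(4))
      next
        case 2
        then show ?thesis by (simp only:)
      next
        case 3
        then show ?thesis by (simp only: vv)
      qed
    qed
    then show ?thesis unfolding arcs_def by blast
  qed
qed

lemma coset_graph_extend:
  assumes "subgroup H F"
  shows "coset_graph H E \<Longrightarrow> v \<in> verts E \<Longrightarrow> w \<in> words B \<Longrightarrow>
    \<exists>E' u. coset_graph H E' \<and> E \<subseteq> E' \<and> path E' v w u"
proof (induction w arbitrary: E v)
  case (Cons l w)
  obtain E1 s where E1: "coset_graph H E1" "E \<subseteq> E1" "(v, l, s) \<in> E1"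
    using coset_graph_step[OF assms, of E v l] Cons.prems by auto
  then have "s \<in> verts E1" using verts_target[of B E1 v l s] unfolding coset_graph_def by blast
  moreover have "w \<in> words B" using Cons.prems(3) by simp
  ultimately obtain E' u where "coset_graph H E'" "E1 \<subseteq> E'" "path E' s w u"
    using Cons.IH[OF E1(1)] by blast
  then show ?case using E1 by (intro exI[of _ E'] exI[of _ u]) auto
qed auto

lemma coset_graph_reads:
  assumes "subgroup H F" "finite W" "W \<subseteq> words B"
  shows "\<exists>E. coset_graph H E \<and> (\<forall>w \<in> W. \<exists>u. path E [] w u)"
  using assms(2,3)
proof (induction W rule: finite_induct)
  case empty
  have "coset_graph H {}" by (simp add: coset_graph_def pgraph_empty verts_def)
  then show ?case by blast
next
  case (insert w W)
  then obtain E where E: "coset_graph H E" "\<forall>w \<in> W. \<exists>u. path E [] w u" by auto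
  obtain E' where "coset_graph H E'" "E \<subseteq> E'" "\<exists>u. path E' [] w u"
    using coset_graph_extend[OF assms(1) E(1), of "[]" w] insert.prems by auto
  then show ?case using E(2) path_mono[OF _ \<open>E \<subseteq> E'\<close>] by (intro exI[of _ E']) blast
qed

text \<open>Loops return to the coset \<open>H\<close>, so they spell elements of \<open>H\<close>;
  words for the generators can be read and end at the coset \<open>H\<close>, whose only name is
  \<open>[]\<close>. Without stubs the finite graph would name every coset.\<close>

lemma subgroup_graph:
  assumes "finitely_generated_subgroup F H" "infinite_index F H"
  shows "\<exists>E. pgraph B E \<and> finite E \<and> stab E = H \<and> stubs B E \<noteq> {}"
proof -
  obtain S where H: "subgroup H F" and S: "finite S" "S \<subseteq> carrier F" "generate F S = H"
    using assms(1) by (auto simp: finitely_generated_subgroup_def)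
  have "\<forall>x \<in> S. \<exists>w. w \<in> words B \<and> word_val F w = x" using S(2) carrier_word by blast
  then obtain f where f: "\<And>x. x \<in> S \<Longrightarrow> f x \<in> words B \<and> word_val F (f x) = x" by metis
  obtain E where E: "coset_graph H E" "\<And>x. x \<in> S \<Longrightarrow> \<exists>u. path E [] (f x) u"
    using coset_graph_reads[OF H finite_imageI[OF S(1)], of f] f by blast
  have pg: "pgraph B E" "finite E" and inj: "inj_on (\<lambda>v. H #> word_val F v) (verts E)"
    using E(1) unfolding coset_graph_def by blast+
  have "stab E \<subseteq> H"
  proof
    fix x assume "x \<in> stab E"
    then obtain w where w: "x = word_val F w" "path E [] w []" by (auto simp: stab_def)
    then have "H #> x = H #> \<one>" using coset_graph_path[OF H E(1) w(2)] by simp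
    then show "x \<in> H"
      using rcos_eq_iff[OF H, of x \<one>] path_carrier[OF pg(1) w(2)] w(1) by simp
  qed
  moreover have "H \<subseteq> stab E"
  proof -
    have "x \<in> stab E" if x: "x \<in> S" for x
    proof -
      obtain u where u: "path E [] (f x) u" using E(2)[OF x] by blast
      have "x \<in> H" using x S(3) generate.incl by metis
      then have "H #> word_val F [] = H #> x"
        using rcos_eq_iff[OF H, of x \<one>] S(2) x by auto
      also have "\<dots> = H #> word_val F u" using coset_graph_path[OF H E(1) u] f[OF x] by simp
      finally have "u = []" using inj_onD[OF inj] path_verts[OF pg(1) u] verts_Nil by metis
      then show ?thesis using u f[OF x] unfolding stab_def by (intro CollectI exI[of _ "f x"]) simp
    qed
    then show ?thesis using generate_subgroup_incl[OF _ stab_subgroup[OF pg(1)], of S] S(3) by blast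
  qed
  moreover have "stubs B E \<noteq> {}"
  proof
    assume no: "stubs B E = {}"
    have total: "\<exists>u. path E v w u" if "v \<in> verts E" "w \<in> words B" for v w
      by (rule path_total[OF pg(1) no that])
    have "rcosets\<^bsub>F\<^esub> H \<subseteq> (\<lambda>v. H #> word_val F v) ` verts E"
    proof
      fix C assume "C \<in> rcosets\<^bsub>F\<^esub> H"
      then obtain g where g: "g \<in> carrier F" "C = H #> g" by (auto simp: RCOSETS_def)
      obtain w where w: "w \<in> words B" "word_val F w = g" using carrier_word[OF g(1)] .
      obtain u where u: "path E [] w u" using total[OF verts_Nil w(1)] by blast
      then show "C \<in> (\<lambda>v. H #> word_val F v) ` verts E"
        using coset_graph_path[OF H E(1) u] g w path_verts[OF pg(1) u] by auto
    qed
    then show False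
      using assms(2) finite_verts[OF pg(2)] finite_subset unfolding infinite_index_def by blast
  qed
  ultimately show ?thesis using pg by blast
qed

end

section \<open>Growth\<close>

context labels
begin

lemma finite_words_le: "finite {w \<in> words B. length w \<le> n}"
proof (rule finite_subset)
  show "{w \<in> words B. length w \<le> n} \<subseteq> {w. set w \<subseteq> UNIV \<times> B \<and> length w \<le> n}"
    by (auto simp: words_def)
  show "finite {w. set w \<subseteq> (UNIV :: bool set) \<times> B \<and> length w \<le> n}"
    using finB by (intro finite_lists_length_le) simp
qed

lemma card_letters: "card ((UNIV :: bool set) \<times> B) = 2 * card B"
  by (simp add: card_cartesian_product)

lemma card_sphere_le:
  "card {w \<in> reduced_words B. length w = Suc n} \<le> 2 * card B * (2 * card B - 1) ^ n"
proof (induction n)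
  case 0
  have "{w \<in> reduced_words B. length w = Suc 0} \<subseteq> (\<lambda>l. [l]) ` (UNIV \<times> B)"
    by (auto simp: reduced_words_eq length_Suc_conv)
  then have "card {w \<in> reduced_words B. length w = Suc 0} \<le> card ((UNIV :: bool set) \<times> B)"
    by (rule surj_card_le[rotated]) (simp add: finB)
  then show ?case by (simp add: card_letters)
next
  case (Suc n)
  let ?S = "\<lambda>n. {w \<in> reduced_words B. length w = Suc n}"
  let ?N = "\<lambda>w. (\<lambda>l. w @ [l]) ` (UNIV \<times> B - {linv (last w)})"
  have fin: "finite (?S n)"
    by (rule finite_subset[OF _ finite_words_le[of "Suc n"]]) (auto simp: reduced_words_eq)
  have "?S (Suc n) \<subseteq> (\<Union>w \<in> ?S n. ?N w)"
  proof
    fix w assume w: "w \<in> ?S (Suc n)"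
    then obtain u l where u: "w = u @ [l]" by (cases w rule: rev_exhaust) auto
    then have "u \<in> ?S n" "w \<in> ?N u"
      using w by (auto simp: reduced_words_eq successively_append_iff mem_Times_iff)
    then show "w \<in> (\<Union>w \<in> ?S n. ?N w)" by blast
  qed
  then have "card (?S (Suc n)) \<le> card (\<Union>w \<in> ?S n. ?N w)"
    using fin finB by (intro card_mono) auto
  also have "\<dots> \<le> (\<Sum>w \<in> ?S n. card (?N w))" by (rule card_UN_le[OF fin])
  also have "\<dots> \<le> (\<Sum>w \<in> ?S n. 2 * card B - 1)"
  proof (rule sum_mono)
    fix w assume w: "w \<in> ?S n"
    then have "w \<noteq> []" by auto
    then have "last w \<in> set w" by simp
    then have "snd (last w) \<in> B" using w by (auto simp: reduced_words_eq words_def)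
    then have "linv (last w) \<in> UNIV \<times> B" by (auto simp: mem_Times_iff)
    then have "card (UNIV \<times> B - {linv (last w)}) = 2 * card B - 1"
      using finB by (simp add: card_letters)
    then show "card (?N w) \<le> 2 * card B - 1"
      using card_image_le[of "UNIV \<times> B - {linv (last w)}" "\<lambda>l. w @ [l]"] finB by simp
  qed
  also have "\<dots> = card (?S n) * (2 * card B - 1)" by simp
  also have "\<dots> \<le> (2 * card B * (2 * card B - 1) ^ n) * (2 * card B - 1)"
    using Suc by (rule mult_le_mono1)
  finally show ?case by (simp add: mult_ac)
qed

text \<open>The constant \<open>3\<close> closes the induction:
  \<open>3 + (q + 1) \<le> 3 * q\<close> holds because at least two generators give
  \<open>q \<ge> 3\<close>.\<close>

lemma card_ball_le: "real (card {w \<in> reduced_words B. length w \<le> n}) \<le> 3 * q ^ n"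
proof (induction n)
  case 0
  have "{w \<in> reduced_words B. length w \<le> 0} = {[]}" by (auto simp: reduced_words_eq)
  then show ?case by simp
next
  case (Suc n)
  have "{w \<in> reduced_words B. length w \<le> Suc n} =
      {w \<in> reduced_words B. length w \<le> n} \<union> {w \<in> reduced_words B. length w = Suc n}" by auto
  then have "card {w \<in> reduced_words B. length w \<le> Suc n} \<le>
      card {w \<in> reduced_words B. length w \<le> n} + card {w \<in> reduced_words B. length w = Suc n}"
    by (simp add: card_Un_le)
  then have "real (card {w \<in> reduced_words B. length w \<le> Suc n}) \<le>
      3 * q ^ n + real (2 * card B * (2 * card B - 1) ^ n)"
    using Suc card_sphere_le[of n] by linarith
  also have "real (2 * card B * (2 * card B - 1) ^ n) = (q + 1) * q ^ n"
    using card_gt by (simp add: of_nat_diff)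
  also have "3 * q ^ n + (q + 1) * q ^ n = (q + 4) * q ^ n" by (simp add: algebra_simps)
  also have "\<dots> \<le> (3 * q) * q ^ n"
    using card_gt by (intro mult_right_mono) auto
  also have "\<dots> = 3 * q ^ Suc n" by simp
  finally show ?case .
qed

text \<open>
  The identity for the subgraph spanned by the vertices of length at most \<open>m\<close>: its stubs lie at
  length \<open>m\<close>, except for those where a non-tree edge of the whole graph leaves the ball.
\<close>

lemma card_sphere_ge:
  assumes "pgraph B G" "\<And>v l. v \<in> verts G \<Longrightarrow> snd l \<in> B \<Longrightarrow> \<exists>u. (v, l, u) \<in> G"
    "\<And>D. finite D \<Longrightarrow> D \<subseteq> nontree G \<Longrightarrow> (\<Sum>(v, l, u) \<in> D. 1 / q ^ length v) \<le> bound"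
  shows "real (card {v \<in> verts G. length v = m}) \<ge> (2 * real (card B) - bound) / (2 * real (card B)) * q ^ m"
proof -
  let ?f = "\<lambda>v :: (bool \<times> 'a) list. 1 / q ^ length v"
  define E where "E = {(v, l, u) \<in> G. length v \<le> m \<and> length u \<le> m}"
  let ?S = "{v \<in> verts G. length v = m}"
  have EG: "E \<subseteq> G" by (auto simp: E_def)
  have vG: "verts G \<subseteq> words B" using verts_words[OF assms(1)] by blast
  have "E \<subseteq> {w \<in> words B. length w \<le> m} \<times> (UNIV \<times> B) \<times> {w \<in> words B. length w \<le> m}"
    unfolding E_def using vG
    by (auto dest: verts_source verts_target[OF assms(1)] pgraph_letter[OF assms(1)])
  then have fE: "finite E"
    by (rule finite_subset) (simp add: finite_words_le finB)
  have pgE: "pgraph B E"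
    unfolding pgraph_def inv_graph_def
  proof (intro conjI allI impI)
    fix s l t assume "(s, l, t) \<in> E"
    then show "(t, linv l, s) \<in> E" by (auto simp: E_def dest: pgraph_sym[OF assms(1)])
  next
    fix s l t t' assume "(s, l, t) \<in> E" "(s, l, t') \<in> E"
    then show "t = t'" using EG pgraph_det[OF assms(1)] by blast
  next
    fix s l t assume "(s, l, t) \<in> E"
    then show "snd l \<in> B" using EG pgraph_letter[OF assms(1)] by blast
  next
    fix s l t assume "(s, l, t) \<in> E" "s \<noteq> []"
    then show "(butlast s, last s, s) \<in> E"
      by (auto simp: E_def dest: verts_source intro: pgraph_tree[OF assms(1)])
  qed
  have vE: "v \<in> verts G" "length v \<le> m" if "v \<in> verts E" for v
    using that verts_mono[OF EG] verts_cases[OF that] by (auto simp: E_def)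
  have fS: "finite ?S"
    by (rule finite_subset[OF _ finite_words_le[of m]]) (use vG in auto)
  have fst: "finite (stubs B E)"
    by (rule finite_subset[of _ "verts E \<times> UNIV \<times> B"])
      (auto simp: stubs_def finite_verts[OF fE] finB)
  define St where "St = {(v, l) \<in> stubs B E. length v < m}"
  have St: "finite St" by (rule finite_subset[OF _ fst]) (auto simp: St_def)
  have "\<forall>x \<in> St. \<exists>u. (fst x, snd x, u) \<in> G"
    using assms(2) vE(1) by (auto simp: St_def stubs_def)
  then obtain h where h: "\<And>x. x \<in> St \<Longrightarrow> (fst x, snd x, h x) \<in> G" by metis
  define D where "D = (\<lambda>x. (fst x, snd x, h x)) ` St"
  have far: "length (h x) > m" if "x \<in> St" for x
  proof (rule ccontr)
    assume "\<not> length (h x) > m"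
    then have "(fst x, snd x, h x) \<in> E" using h[OF that] that by (auto simp: E_def St_def)
    then show False using that by (auto simp: St_def stubs_def)
  qed
  \<comment> \<open>A tree edge changes the length of the name by one, so an edge that jumps from
    below \<open>m\<close> to above \<open>m\<close> cannot be one.\<close>
  have DG: "D \<subseteq> nontree G"
  proof
    fix y assume "y \<in> D"
    then obtain x where x: "x \<in> St" "y = (fst x, snd x, h x)" by (auto simp: D_def)
    have len: "length (h x) > m" "length (fst x) < m" using far x by (auto simp: St_def)
    then have "h x \<noteq> fst x @ [snd x]" "fst x \<noteq> h x @ [linv (snd x)]"
      by (metis Suc_leI length_append_singleton linorder_not_less)
        (metis len Suc_lessD length_append_singleton less_trans_Suc not_less_iff_gr_or_eq)
    then show "y \<in> nontree G" using h[OF x(1)] x(2) by (simp add: nontree_def)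
  qed
  have DE: "D \<inter> nontree E = {}"
    using far by (fastforce simp: D_def E_def nontree_def)
  have NG: "nontree E \<subseteq> nontree G" using EG by (auto simp: nontree_def)
  have fN: "finite (nontree E)" by (rule finite_subset[OF _ fE]) (auto simp: nontree_def)
  have fD: "finite D" using St by (simp add: D_def)
  have injD: "inj_on (\<lambda>x. (fst x, snd x, h x)) St" by (auto simp: inj_on_def prod_eq_iff)
  have sumD: "(\<Sum>(v, l) \<in> St. ?f v) = (\<Sum>(v, l, u) \<in> D. ?f v)"
    unfolding D_def sum.reindex[OF injD] by (simp add: case_prod_beta)
  \<comment> \<open>The jumping edges and the non-tree edges inside the ball are different non-tree
    edges of \<open>G\<close>, so one budget covers both.\<close>
  have low: "(\<Sum>(v, l) \<in> St. ?f v) + loss q E \<le> bound"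
  proof -
    have "(\<Sum>(v, l) \<in> St. ?f v) + loss q E = (\<Sum>(v, l, u) \<in> D \<union> nontree E. ?f v)"
      unfolding sumD loss_def using fD fN DE by (simp add: sum.union_disjoint)
    also have "\<dots> \<le> bound" using assms(3) fD fN DG NG by simp
    finally show ?thesis .
  qed
  have high: "(\<Sum>(v, l) \<in> stubs B E - St. ?f v) \<le> 2 * real (card B) * real (card ?S) / q ^ m"
  proof -
    have sub: "stubs B E - St \<subseteq> ?S \<times> UNIV \<times> B"
      using vE by (fastforce simp: St_def stubs_def)
    have "(\<Sum>(v, l) \<in> stubs B E - St. ?f v) = (\<Sum>x \<in> stubs B E - St. 1 / q ^ m)"
      using sub by (intro sum.cong) auto
    also have "\<dots> = real (card (stubs B E - St)) * (1 / q ^ m)" by simp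
    also have "\<dots> \<le> real (card (?S \<times> (UNIV :: bool set) \<times> B)) * (1 / q ^ m)"
    proof (rule mult_right_mono)
      have "card (stubs B E - St) \<le> card (?S \<times> (UNIV :: bool set) \<times> B)"
        by (rule card_mono[OF _ sub]) (simp add: fS finB)
      then show "real (card (stubs B E - St)) \<le> real (card (?S \<times> (UNIV :: bool set) \<times> B))"
        by (rule of_nat_mono)
    qed (use q_gt in simp)
    also have "card (?S \<times> (UNIV :: bool set) \<times> B) = card ?S * (2 * card B)"
      by (simp only: card_cartesian_product[of ?S] card_letters)
    finally show ?thesis by (simp add: mult_ac)
  qed
  have "2 * real (card B) = (\<Sum>(v, l) \<in> stubs B E. ?f v) + loss q E"
    using loss_identity[OF pgE fE finB refl] q_gt by simp
  also have "(\<Sum>(v, l) \<in> stubs B E. ?f v)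
      = (\<Sum>(v, l) \<in> stubs B E - St. ?f v) + (\<Sum>(v, l) \<in> St. ?f v)"
    using fst by (intro sum.subset_diff) (auto simp: St_def)
  finally have "2 * real (card B) - bound \<le> 2 * real (card B) * real (card ?S) / q ^ m"
    using low high by linarith
  then show ?thesis using q_gt card_gt by (simp add: field_simps)
qed

end

section \<open>Cosets and vertices\<close>

context free_group
begin

lemma coset_of_path:
  assumes "pgraph B G" "path G [] w v"
  shows "stab G #> word_val F w = stab G #> word_val F v"
proof -
  have v: "v \<in> verts G" using path_verts[OF assms] by simp
  have c: "w \<in> words (carrier F)" "v \<in> words (carrier F)"
    using path_carrier[OF assms] verts_carrier[OF assms(1) v] .
  have "hol [] w v \<in> stab G" using hol_stab[OF assms] by simp
  then show ?thesis
    using c rcos_eq_iff[OF stab_subgroup[OF assms(1)]]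
    by (simp add: hol_def word_val_append word_val_winv)
qed

text \<open>Equality of cosets provides only some loop with the value of \<open>v @ winv u\<close>.
  As \<open>G\<close> is complete, that word itself can be read from the base point and must end
  where the loop ends; hence \<open>winv u\<close> leads from \<open>v\<close> to
  \<open>[]\<close>.\<close>

lemma coset_of_vert_inj:
  assumes "pgraph B G" "\<And>v l. v \<in> verts G \<Longrightarrow> snd l \<in> B \<Longrightarrow> \<exists>u. (v, l, u) \<in> G"
    "v \<in> verts G" "u \<in> verts G" "stab G #> word_val F v = stab G #> word_val F u"
  shows "v = u"
proof -
  note inv = pgraph_inv_graph[OF assms(1)]
  have total: "\<exists>t. path G s w t" if "s \<in> verts G" "w \<in> words B" for s w
    by (rule path_total[OF assms(1) _ that]) (use assms(2) in \<open>auto simp: stubs_def\<close>)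
  have B: "v \<in> words B" "u \<in> words B" using verts_words[OF assms(1)] assms(3,4) by auto
  then have "word_val F (v @ winv u) \<in> stab G"
    using rcos_eq_iff[OF stab_subgroup[OF assms(1)]] assms(5)
    by (simp add: word_val_append word_val_winv words_carrier)
  then obtain w where w: "word_val F w = word_val F (v @ winv u)" "path G [] w []"
    by (auto simp: stab_def)
  obtain t where t: "path G v (winv u) t" using total[OF assms(3), of "winv u"] B by auto
  then have vt: "path G [] (v @ winv u) t"
    using path_to_vert[OF assms(1,3)] by (auto simp: path_append)
  have "t = []"
    using path_cong_word_val[OF inv _ path_words[OF assms(1) w(2)] w(1)[symmetric] vt w(2)] B by simp
  then show "v = u"
    using t path_to_vert[OF assms(1,4)] path_det[OF inv] path_winv_iff[OF inv] by metis
qed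

end

theorem corollary8:
  fixes F :: "('a, 'b) monoid_scheme" and B :: "'a set" and r :: nat and H :: "'a set"
  assumes "group F"
    and "free_basis F B" and "finite B" and "card B = r" and "r > 1"
    and "finitely_generated_subgroup F H" and "infinite_index F H"
  shows "\<exists>K. free_factor F H K \<and> burnside_subgroup F K \<and> infinite_index F K \<and>
             (\<forall>k. k_transitive_on_cosets F K k) \<and> maximal_growth F B K"
proof -
  interpret free_group F B
    using assms(1,2) by (simp add: free_group_def free_group_axioms_def)
  obtain E where E: "pgraph B E" "finite E" "stab E = H" "stubs B E \<noteq> {}"
    using subgroup_graph[OF assms(6,7)] by blast
  \<comment> \<open>\<open>q0\<close> anticipates the \<open>q\<close> of \<open>labels\<close>,
    which becomes available once a bound above the loss has been chosen.\<close>
  define q0 where "q0 = 2 * real (card B) - 1"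
  have q0: "q0 > 1" using assms(4,5) by (simp add: q0_def)
  have "loss q0 E < 2 * real (card B)"
  proof -
    have "finite (stubs B E)"
      by (rule finite_subset[of _ "verts E \<times> UNIV \<times> B"])
        (auto simp: stubs_def finite_verts[OF E(2)] assms(3))
    then have "(\<Sum>(v, l) \<in> stubs B E. 1 / q0 ^ length v) > 0"
      using E(4) q0 by (intro sum_pos) auto
    then show ?thesis using loss_identity[OF E(1,2) assms(3) q0_def] q0 by linarith
  qed
  then obtain bound where bnd: "loss q0 E < bound" "bound < 2 * real (card B)"
    using dense by blast
  interpret labels B bound
    using assms(3-5) bnd by unfold_locales auto
  have "good E" using E bnd unfolding good_def q0_def by blast
  from completion[OF this] obtain G where G0: "pgraph B G" "E \<subseteq> G"
    "\<forall>v \<in> verts G. \<forall>c \<in> words B. cyc_red c \<longrightarrow> (\<exists>n > 0. path G v (wpow c n) v)"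
    "\<forall>vs us. distinct vs \<longrightarrow> distinct us \<longrightarrow> length us = length vs \<longrightarrow> set vs \<subseteq> verts G \<longrightarrow>
       set us \<subseteq> verts G \<longrightarrow> (\<exists>b \<in> words B. \<forall>i < length vs. path G (vs ! i) b (us ! i))"
    "\<forall>D. finite D \<longrightarrow> D \<subseteq> nontree G \<longrightarrow> (\<Sum>(v, l, u) \<in> D. 1 / q ^ length v) \<le> bound"
    by (elim exE conjE)
  note G = G0(1,2) G0(3)[rule_format] G0(4)[rule_format] G0(5)[rule_format]
  define K where "K = stab G"
  note K = stab_subgroup[OF G(1), folded K_def]
  \<comment> \<open>Completeness comes from the Burnside property for one-letter words: the orbit of
    \<open>v\<close> under \<open>l\<close> closes up, so its first edge exists.\<close>
  have edge: "\<exists>u. (v, l, u) \<in> G" if vl: "v \<in> verts G" "snd l \<in> B" for v l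
  proof -
    obtain n where "n > 0" "path G v (wpow [l] n) v"
      using G(3)[of v "[l]"] vl by (auto simp: cyc_red_def)
    then show ?thesis by (cases n) auto
  qed
  have total: "\<exists>u. path G v w u" if "v \<in> verts G" "w \<in> words B" for v w
    by (rule path_total[OF G(1) _ that]) (use edge in \<open>auto simp: stubs_def\<close>)
  let ?c = "\<lambda>v. K #>\<^bsub>F\<^esub> word_val F v"
  note coset = coset_of_path[OF G(1), folded K_def]
  have inj: "inj_on ?c (verts G)"
    using coset_of_vert_inj[OF G(1) edge, folded K_def] by (rule inj_onI)
  have rc: "rcosets\<^bsub>F\<^esub> K = ?c ` verts G"
  proof (intro equalityI subsetI)
    fix C assume "C \<in> rcosets\<^bsub>F\<^esub> K"
    then obtain g where g: "g \<in> carrier F" "C = K #>\<^bsub>F\<^esub> g" by (auto simp: RCOSETS_def)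
    obtain w where w: "w \<in> words B" "word_val F w = g" using carrier_word[OF g(1)] .
    obtain u where u: "path G [] w u" using total[OF verts_Nil w(1)] by blast
    then show "C \<in> ?c ` verts G" using coset[OF u] w g path_verts[OF G(1) u] by auto
  next
    fix C assume "C \<in> ?c ` verts G"
    then show "C \<in> rcosets\<^bsub>F\<^esub> K" using verts_carrier[OF G(1)] by (auto simp: RCOSETS_def)
  qed
  define \<delta> where "\<delta> = (2 * real (card B) - bound) / (2 * real (card B))"
  have \<delta>: "\<delta> > 0" using bound card_gt by (simp add: \<delta>_def)
  have sphere: "real (card {v \<in> verts G. length v = m}) \<ge> \<delta> * q ^ m" for m
    unfolding \<delta>_def by (rule card_sphere_ge[OF G(1) edge G(5)])

  have "free_factor F H K"
  proof -
    interpret subgraph F B E G using E(1) G(1,2) by unfold_locales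
    show ?thesis using free_factor_stab E(3) by (simp add: K_def)
  qed
  moreover have "burnside_subgroup F K"
    unfolding burnside_subgroup_def
  proof (intro conjI ballI K)
    fix g assume "g \<in> carrier F"
    then obtain w where w: "w \<in> words B" "word_val F w = g" by (rule carrier_word)
    obtain u c where uc: "u \<in> words B" "c \<in> words B" "c = [] \<or> cyc_red c"
      "g = word_val F (u @ c @ winv u)" using cyc_red_conjugate[OF w(1)] w(2) by blast
    obtain v where v: "path G [] u v" using total[OF verts_Nil uc(1)] by blast
    then have "v \<in> verts G" using path_verts[OF G(1)] by simp
    then have "\<exists>n > 0. path G v (wpow c n) v"
      using G(3) uc(2,3) path_wpow_loop[of G v "[]" 1] by (cases "c = []") auto
    then obtain n where n: "n > 0" "path G v (wpow c n) v" by blast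
    have "g [^]\<^bsub>F\<^esub> n = word_val F (u @ wpow c n @ winv u)"
    proof -
      have "word_val F (wpow (u @ c @ winv u) m) = word_val F (u @ wpow c m @ winv u)" for m
      proof (induction m)
        case (Suc m)
        have "inv\<^bsub>F\<^esub> word_val F u \<otimes>\<^bsub>F\<^esub> (word_val F u \<otimes>\<^bsub>F\<^esub> x) = x" if "x \<in> carrier F" for x
          using words_carrier[OF uc(1)] that by (simp flip: m_assoc)
        then show ?case using Suc words_carrier[OF uc(1)] words_carrier[OF uc(2)]
          by (simp add: word_val_append word_val_winv wpow_words m_assoc)
      qed (use words_carrier[OF uc(1)] in \<open>simp add: word_val_append word_val_winv\<close>)
      then show ?thesis using uc word_val_wpow[of "u @ c @ winv u" n] by (simp add: words_carrier)
    qed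
    moreover have "path G [] (u @ wpow c n @ winv u) []"
      using v n(2) path_winv[OF pgraph_inv_graph[OF G(1)] v] by (auto simp: path_append)
    ultimately have "g [^]\<^bsub>F\<^esub> n \<in> K" unfolding K_def stab_def by auto
    then show "\<exists>n::nat. n > 0 \<and> g [^]\<^bsub>F\<^esub> n \<in> K" using n(1) by blast
  qed
  moreover have "infinite_index F K"
    unfolding infinite_index_def rc
  proof
    assume "finite (?c ` verts G)"
    \<comment> \<open>The estimate \<open>sphere\<close> makes vertices exist at every depth, so
      lengths of names are unbounded.\<close>
    then have "finite (length ` verts G)" using inj finite_imageD by blast
    then obtain m where m: "\<And>v. v \<in> verts G \<Longrightarrow> length v < m"
      unfolding finite_nat_set_iff_bounded by blast
    then have "{v \<in> verts G. length v = m} = {}" by blast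
    then have "\<delta> * q ^ m \<le> 0" using sphere[of m] by (simp only: card.empty of_nat_0)
    moreover have "q ^ m > 0" using q_gt by (intro zero_less_power) linarith
    ultimately show False using \<delta> mult_pos_pos[of \<delta> "q ^ m"] by linarith
  qed
  moreover have "k_transitive_on_cosets F K k" for k
    unfolding k_transitive_on_cosets_def
  proof (intro allI impI, elim conjE)
    fix Cs Ds
    assume Cs: "length Cs = k" "distinct Cs" "set Cs \<subseteq> rcosets\<^bsub>F\<^esub> K"
      and Ds: "length Ds = k" "distinct Ds" "set Ds \<subseteq> rcosets\<^bsub>F\<^esub> K"
    have "\<forall>C \<in> rcosets\<^bsub>F\<^esub> K. \<exists>v. v \<in> verts G \<and> ?c v = C" unfolding rc by auto
    then obtain \<rho> where \<rho>: "\<And>C. C \<in> rcosets\<^bsub>F\<^esub> K \<Longrightarrow> \<rho> C \<in> verts G \<and> ?c (\<rho> C) = C" by metis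
    then have inj: "inj_on \<rho> (rcosets\<^bsub>F\<^esub> K)" by (metis inj_onI)
    have "distinct (map \<rho> Cs)" "distinct (map \<rho> Ds)"
      unfolding distinct_map
      using Cs(2) Ds(2) inj_on_subset[OF inj Cs(3)] inj_on_subset[OF inj Ds(3)] by simp_all
    moreover have "set (map \<rho> Cs) \<subseteq> verts G" "set (map \<rho> Ds) \<subseteq> verts G"
      using Cs Ds \<rho> by auto
    ultimately obtain b where b: "b \<in> words B"
      "\<And>i. i < k \<Longrightarrow> path G (\<rho> (Cs ! i)) b (\<rho> (Ds ! i))"
      using G(4)[of "map \<rho> Cs" "map \<rho> Ds"] Cs(1) Ds(1) by auto
    show "\<exists>b \<in> carrier F. \<forall>i < k. (Cs ! i) #>\<^bsub>F\<^esub> b = Ds ! i"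
    proof (intro bexI allI impI)
      show "word_val F b \<in> carrier F" using b(1) words_carrier by simp
      fix i assume i: "i < k"
      have C: "Cs ! i \<in> rcosets\<^bsub>F\<^esub> K" "Ds ! i \<in> rcosets\<^bsub>F\<^esub> K"
        using subsetD[OF Cs(3) nth_mem] subsetD[OF Ds(3) nth_mem] i Cs(1) Ds(1) by simp_all
      have v: "\<rho> (Cs ! i) \<in> verts G" using \<rho>[OF C(1)] by simp
      have "(Cs ! i) #>\<^bsub>F\<^esub> word_val F b = ?c (\<rho> (Cs ! i)) #>\<^bsub>F\<^esub> word_val F b" using \<rho>[OF C(1)] by simp
      also have "\<dots> = ?c (\<rho> (Cs ! i) @ b)"
        using coset_mult_assoc[OF subgroup.subset[OF K]] verts_carrier[OF G(1) v] words_carrier[OF b(1)]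
        by (simp add: word_val_append)
      also have "\<dots> = ?c (\<rho> (Ds ! i))"
        using path_to_vert[OF G(1) v] b(2)[OF i] by (intro coset) (auto simp: path_append)
      also have "\<dots> = Ds ! i" using \<rho>[OF C(2)] by simp
      finally show "(Cs ! i) #>\<^bsub>F\<^esub> word_val F b = Ds ! i" .
    qed
  qed
  moreover have "maximal_growth F B K"
  proof -
    let ?R = "\<lambda>n. {w \<in> reduced_words B. length w \<le> n}"
    have finR: "finite (?R n)" for n
      by (rule finite_subset[OF _ finite_words_le[of n]]) (auto simp: reduced_words_eq)
    have finW: "finite (word_ball F B n)" for n
      unfolding word_ball_def using finR by simp
    have ball_carrier: "word_ball F B n \<subseteq> carrier F" for n
      unfolding word_ball_def using words_carrier by (auto simp: reduced_words_eq)
    have triv: "coset_growth F B {\<one>\<^bsub>F\<^esub>} n = card (word_ball F B n)" for n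
    proof -
      have "{\<one>\<^bsub>F\<^esub>} #>\<^bsub>F\<^esub> x = {x}" if "x \<in> carrier F" for x using that by (auto simp: r_coset_def)
      then have "inj_on (\<lambda>w. {\<one>\<^bsub>F\<^esub>} #>\<^bsub>F\<^esub> w) (word_ball F B n)"
        using ball_carrier[of n] by (auto simp: inj_on_def subset_iff)
      then show ?thesis unfolding coset_growth_def by (rule card_image)
    qed
    have upper: "coset_growth F B K n \<le> coset_growth F B {\<one>\<^bsub>F\<^esub>} n" for n
      unfolding triv unfolding coset_growth_def by (rule card_image_le[OF finW])
    have lower: "\<delta> * q ^ n \<le> real (coset_growth F B K n)" for n
    proof -
      let ?S = "{v \<in> verts G. length v = n}"
      \<comment> \<open>Names are reduced words, so vertices at depth \<open>n\<close> are reached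
        by elements of the ball.\<close>
      have "?c ` ?S \<subseteq> (\<lambda>w. K #>\<^bsub>F\<^esub> w) ` word_ball F B n"
        unfolding word_ball_def
        using verts_words[OF G(1)] verts_red[OF G(1)] by (fastforce simp: reduced_words_eq)
      then have "card (?c ` ?S) \<le> coset_growth F B K n"
        unfolding coset_growth_def using finW by (intro card_mono) auto
      moreover have "card (?c ` ?S) = card ?S"
        using inj by (intro card_image) (auto intro: inj_on_subset)
      ultimately show ?thesis using sphere[of n] by linarith
    qed
    \<comment> \<open>The shift \<open>C\<close> absorbs the ratio of the constant \<open>3\<close>
      in the upper bound to the density \<open>\<delta>\<close> in the lower one.\<close>
    obtain C where C: "3 / \<delta> < q ^ C" using real_arch_pow[OF q_gt] by blast
    have "coset_growth F B {\<one>\<^bsub>F\<^esub>} n \<le> coset_growth F B K (n + C)" for n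
    proof -
      have "real (coset_growth F B {\<one>\<^bsub>F\<^esub>} n) \<le> real (card (?R n))"
        unfolding triv word_ball_def using card_image_le[OF finR] by simp
      also have "\<dots> \<le> 3 * q ^ n" by (rule card_ball_le)
      also have "\<dots> \<le> (\<delta> * q ^ C) * q ^ n"
        using C \<delta> q_gt by (intro mult_right_mono) (auto simp: field_simps)
      also have "\<dots> = \<delta> * q ^ (n + C)" by (simp add: power_add mult_ac)
      also have "\<dots> \<le> real (coset_growth F B K (n + C))" by (rule lower)
      finally show ?thesis by simp
    qed
    then show ?thesis
      unfolding maximal_growth_def growth_equivalent_def using upper
      by (intro exI[of _ 0] exI[of _ C]) auto
  qed
  ultimately show ?thesis by blast
qed

end
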